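(* Let $\Gamma=(N,A,\mathcal F,\Xi,u)$ be a strategic form game with finitely additive strategies. Then the set of perfect equilibria of $\Gamma$ is non-empty and compact.
   Context: A directed set $(I,\le)$ is a non-empty set with a reflexive, transitive relation such that every pair has an upper bound and there is no maximal element (for every $\alpha$ there is $\beta\ge\alpha$ with $\beta\neq\alpha$). Nets are indexed by directed sets; convergence is as usual. A field on a set $X$ is a collection of subsets containing $\emptyset$ and closed under complements and finite unions. A charge on a field is a finitely additive $[0,1]$-valued set function with total mass $1$. A strategic form game with finitely additive strategies $\Gamma=(N,A,\mathcal F,\Xi,u)$ consists of: $N=\{1,\dots,n\}$; $A=\prod_{i\in N}A_i$ with each $A_i$ non-empty; $\mathcal F=(\mathcal F_i)_{i\in N}$ with $\mathcal F_i$ a field on $A_i$ containing all singletons; $\Xi=\prod_i\Xi_i$, where $\Xi_i$ is the set of all charges on $\mathcal F_i$; and bounded functions $u_i\colon A\to\mathbb R$, each of which is a uniform limit of simple functions. A rectangle is a set $R=\prod_iR_i$ with $R_i\in\mathcal F_i$, and $\kappa(R)=\prod_i\kappa_i(R_i)$ for $\kappa\in\Xi$; a simple function is a finite sum $f=\sum_\ell c_\ell\mathbb I_{R^\ell}$ with $R^\ell$ rectangles and $c_\ell\in\mathbb R$, and $\kappa(f)=\sum_\ell c_\ell\kappa(R^\ell)$. The payoff function $U_i\colon\Xi\to\mathbb R$ is the expected payoff $U_i(\kappa)=\sup\{\kappa(f)\mid f\text{ simple},f\le u_i\}=\inf\{\kappa(g)\mid g\text{ simple},g\ge u_i\}$ (these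 agree for uniform limits of simple functions). $\Xi$ has the Tychonov topology: the smallest topology containing all sets $\{\tau\in\Xi\mid|\kappa(R^k)-\tau(R^k)|<\varepsilon,\ k=1,\dots,\ell\}$ with $\kappa\in\Xi$, $\varepsilon>0$ and rectangles $R^1,\dots,R^\ell$. $(\tau_i\mid\sigma)$ is the profile $\sigma$ with $\sigma_i$ replaced by $\tau_i$. $\tau_i\in\Xi_i$ is a best response to $\sigma\in\Xi$ if $U_i(\tau_i\mid\sigma)\ge U_i(\tau_i'\mid\sigma)$ for all $\tau_i'\in\Xi_i$; a profile $\tau$ is a best response to $\sigma$ if each $\tau_i$ is. $\sigma$ is a Nash equilibrium if it is a best response to itself. The carrier of $\sigma_i\in\Xi_i$ is $\mathcal C_i(\sigma_i)=\{E\in\mathcal F_i\mid\sigma_i(E)>0\}$, and $\mathcal C(\sigma)=\prod_i\mathcal C_i(\sigma_i)$. A carrier is a set of the form $\mathcal C(\sigma)$ with $\sigma\in\Xi$. A net $(\sigma_\alpha)_{\alpha\in I}$ in $\Xi$ is completely mixed if for every carrier $\mathcal C$ there is $\alpha\in I$ with $\mathcal C\subseteq\mathcal C(\sigma_\beta)$ for all $\beta\ge\alpha$. $\sigma$ is perfect if there are a completely mixed net $(\sigma_\alpha)_{\alpha\in I}$ and a net $(\kappa_\alpha)_{\alpha\in I}$ in $\Xi$, both converging to $\sigma$, such that $\kappa_\alpha$ is a best response to $\sigma_\alpha$ for each $\alpha\in I$. A perfect equilibrium is a Nash equilibrium that is perfect. *)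

theory Defs
  imports "HOL-Analysis.Analysis"
begin

section \<open>Directed sets and nets\<close>

text \<open>Antisymmetry is not required. The last conjunct excludes maximal elements.\<close>

definition directed_set :: "'d set \<Rightarrow> ('d \<Rightarrow> 'd \<Rightarrow> bool) \<Rightarrow> bool" where
  "directed_set I le \<longleftrightarrow>
     I \<noteq> {} \<and> reflp_on I le \<and> transp_on I le \<and>
     (\<forall>a\<in>I. \<forall>b\<in>I. \<exists>c\<in>I. le a c \<and> le b c) \<and>
     (\<forall>a\<in>I. \<exists>b\<in>I. le a b \<and> b \<noteq> a)"

text \<open>Convergence of a net \<open>s\<close> on \<open>I\<close> to \<open>x\<close> in \<open>T\<close> is \<open>limitin T s x (tails I le)\<close>.\<close>

definition tails :: "'d set \<Rightarrow> ('d \<Rightarrow> 'd \<Rightarrow> bool) \<Rightarrow> 'd filter" where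
  "tails I le = (INF a\<in>I. principal {b\<in>I. le a b})"

lemma eventually_tails:
  assumes "directed_set I le"
  shows "eventually P (tails I le) \<longleftrightarrow> (\<exists>a\<in>I. \<forall>b\<in>I. le a b \<longrightarrow> P b)"
proof -
  have "eventually P (tails I le) \<longleftrightarrow> (\<exists>a\<in>I. eventually P (principal {b\<in>I. le a b}))"
    unfolding tails_def
  proof (rule eventually_INF_base)
    show "I \<noteq> {}" using assms by (simp add: directed_set_def)
  next
    fix a b assume ab: "a \<in> I" "b \<in> I"
    then obtain c where c: "c \<in> I" "le a c" "le b c"
      using assms unfolding directed_set_def by blast
    have tr: "transp_on I le" using assms by (simp add: directed_set_def)
    have "{d\<in>I. le c d} \<subseteq> {d\<in>I. le a d} \<inter> {d\<in>I. le b d}"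
      using c ab transp_onD[OF tr] by blast
    then show "\<exists>x\<in>I. principal {d\<in>I. le x d} \<le> inf (principal {d\<in>I. le a d}) (principal {d\<in>I. le b d})"
      using c(1) by (auto simp: inf_principal)
  qed
  then show ?thesis by (auto simp: eventually_principal)
qed


section \<open>Finitely additive strategies\<close>

text \<open>A charge is represented by its restriction to the field (\<open>\<rightarrow>\<^sub>E\<close>: it is \<^const>\<open>undefined\<close> off
  \<open>M\<close>), so that charges are equal iff they agree on the field.\<close>

definition charges :: "'a set \<Rightarrow> 'a set set \<Rightarrow> ('a set \<Rightarrow> real) set" where
  "charges \<Omega> M = {\<mu> \<in> M \<rightarrow>\<^sub>E {0..1}. additive M \<mu> \<and> \<mu> \<Omega> = 1}"

text \<open>Profiles are extensional functions on the set of players; all action sets live in one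
  type \<open>'a\<close>.\<close>

locale strategy_fields =
  fixes n :: nat
    and A :: "nat \<Rightarrow> 'a set"
    and F :: "nat \<Rightarrow> 'a set set"
  assumes actions_nonempty: "\<And>i. i \<in> {1..n} \<Longrightarrow> A i \<noteq> {}"
    and field_of_sets: "\<And>i. i \<in> {1..n} \<Longrightarrow> algebra (A i) (F i)"
    and singleton_in_field: "\<And>i a. i \<in> {1..n} \<Longrightarrow> a \<in> A i \<Longrightarrow> {a} \<in> F i"
begin

abbreviation players :: "nat set" where
  "players \<equiv> {1..n}"

abbreviation action_profiles :: "(nat \<Rightarrow> 'a) set" where
  "action_profiles \<equiv> Pi\<^sub>E players A"

definition strategies :: "nat \<Rightarrow> ('a set \<Rightarrow> real) set" where
  "strategies i = charges (A i) (F i)"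

definition profiles :: "(nat \<Rightarrow> 'a set \<Rightarrow> real) set" where
  "profiles = Pi\<^sub>E players strategies"

text \<open>A rectangle \<open>Pi\<^sub>E players R\<close> is given by its family of sides \<open>R\<close>. Different families of
  sides describe the same rectangle only if it is empty, and then \<open>rect_mass\<close> is \<open>0\<close> for both.\<close>

definition sides :: "(nat \<Rightarrow> 'a set) set" where
  "sides = Pi\<^sub>E players F"

definition rect_mass :: "(nat \<Rightarrow> 'a set \<Rightarrow> real) \<Rightarrow> (nat \<Rightarrow> 'a set) \<Rightarrow> real" where
  "rect_mass \<kappa> R = (\<Prod>i\<in>players. \<kappa> i (R i))"

text \<open>\<open>represents m c R f\<close>: on action profiles, \<open>f\<close> is the linear combination of the indicators of
  the rectangles \<open>R 0, \<dots>, R (m - 1)\<close> with coefficients \<open>c\<close>.\<close>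

definition represents ::
  "nat \<Rightarrow> (nat \<Rightarrow> real) \<Rightarrow> (nat \<Rightarrow> nat \<Rightarrow> 'a set) \<Rightarrow> ((nat \<Rightarrow> 'a) \<Rightarrow> real) \<Rightarrow> bool" where
  "represents m c R f \<longleftrightarrow>
     (\<forall>l<m. R l \<in> sides) \<and>
     (\<forall>a\<in>action_profiles. f a = (\<Sum>l<m. c l * indicator (Pi\<^sub>E players (R l)) a))"

definition simple :: "((nat \<Rightarrow> 'a) \<Rightarrow> real) \<Rightarrow> bool" where
  "simple f \<longleftrightarrow> (\<exists>m c R. represents m c R f)"

text \<open>\<open>has_value \<kappa> f v\<close> says \<open>\<kappa>(f) = v\<close>. As a relation it does not presuppose that \<open>\<kappa>(f)\<close> is
  independent of the representation of \<open>f\<close>.\<close>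

definition has_value ::
  "(nat \<Rightarrow> 'a set \<Rightarrow> real) \<Rightarrow> ((nat \<Rightarrow> 'a) \<Rightarrow> real) \<Rightarrow> real \<Rightarrow> bool" where
  "has_value \<kappa> f v \<longleftrightarrow>
     (\<exists>m c R. represents m c R f \<and> v = (\<Sum>l<m. c l * rect_mass \<kappa> (R l)))"

definition strategy_topology :: "(nat \<Rightarrow> 'a set \<Rightarrow> real) topology" where
  "strategy_topology = topology_generated_by
     {{\<tau> \<in> profiles. \<forall>R\<in>\<R>. \<bar>rect_mass \<kappa> R - rect_mass \<tau> R\<bar> < \<epsilon>} | \<kappa> \<epsilon> \<R>.
        \<kappa> \<in> profiles \<and> \<epsilon> > 0 \<and> finite \<R> \<and> \<R> \<subseteq> sides}"

definition carrier_of :: "(nat \<Rightarrow> 'a set \<Rightarrow> real) \<Rightarrow> (nat \<Rightarrow> 'a set) set" where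
  "carrier_of \<sigma> = (\<Pi>\<^sub>E i\<in>players. {E \<in> F i. \<sigma> i E > 0})"

definition carriers :: "(nat \<Rightarrow> 'a set) set set" where
  "carriers = carrier_of ` profiles"

definition completely_mixed ::
  "'d set \<Rightarrow> ('d \<Rightarrow> 'd \<Rightarrow> bool) \<Rightarrow> ('d \<Rightarrow> nat \<Rightarrow> 'a set \<Rightarrow> real) \<Rightarrow> bool" where
  "completely_mixed I le s \<longleftrightarrow>
     (\<forall>C\<in>carriers. \<exists>a\<in>I. \<forall>b\<in>I. le a b \<longrightarrow> C \<subseteq> carrier_of (s b))"

end


section \<open>Games and perfect equilibria\<close>

locale fa_game = strategy_fields n A F
  for n :: nat
    and A :: "nat \<Rightarrow> 'a set"
    and F :: "nat \<Rightarrow> 'a set set" +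
  fixes u :: "nat \<Rightarrow> (nat \<Rightarrow> 'a) \<Rightarrow> real"
  assumes payoff_bounded: "\<And>i. i \<in> players \<Longrightarrow> bounded (u i ` action_profiles)"
    and payoff_uniform_limit: "\<And>i. i \<in> players \<Longrightarrow>
      \<exists>f :: nat \<Rightarrow> (nat \<Rightarrow> 'a) \<Rightarrow> real.
        (\<forall>k. simple (f k)) \<and> uniform_limit action_profiles f (u i) sequentially"
begin

definition expected_payoff :: "nat \<Rightarrow> (nat \<Rightarrow> 'a set \<Rightarrow> real) \<Rightarrow> real" where
  "expected_payoff i \<kappa> =
     Sup {v. \<exists>f. simple f \<and> (\<forall>a\<in>action_profiles. f a \<le> u i a) \<and> has_value \<kappa> f v}"

definition best_response_of ::
  "nat \<Rightarrow> ('a set \<Rightarrow> real) \<Rightarrow> (nat \<Rightarrow> 'a set \<Rightarrow> real) \<Rightarrow> bool" where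
  "best_response_of i t \<sigma> \<longleftrightarrow>
     t \<in> strategies i \<and>
     (\<forall>t'\<in>strategies i. expected_payoff i (\<sigma>(i := t)) \<ge> expected_payoff i (\<sigma>(i := t')))"

definition best_response ::
  "(nat \<Rightarrow> 'a set \<Rightarrow> real) \<Rightarrow> (nat \<Rightarrow> 'a set \<Rightarrow> real) \<Rightarrow> bool" where
  "best_response \<tau> \<sigma> \<longleftrightarrow> (\<forall>i\<in>players. best_response_of i (\<tau> i) \<sigma>)"

definition nash_equilibrium :: "(nat \<Rightarrow> 'a set \<Rightarrow> real) \<Rightarrow> bool" where
  "nash_equilibrium \<sigma> \<longleftrightarrow> \<sigma> \<in> profiles \<and> best_response \<sigma> \<sigma>"

definition perfect_along ::
  "'d set \<Rightarrow> ('d \<Rightarrow> 'd \<Rightarrow> bool) \<Rightarrow> ('d \<Rightarrow> nat \<Rightarrow> 'a set \<Rightarrow> real) \<Rightarrow>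
    ('d \<Rightarrow> nat \<Rightarrow> 'a set \<Rightarrow> real) \<Rightarrow> (nat \<Rightarrow> 'a set \<Rightarrow> real) \<Rightarrow> bool" where
  "perfect_along I le s k \<sigma> \<longleftrightarrow>
     directed_set I le \<and> s ` I \<subseteq> profiles \<and> k ` I \<subseteq> profiles \<and>
     completely_mixed I le s \<and>
     limitin strategy_topology s \<sigma> (tails I le) \<and>
     limitin strategy_topology k \<sigma> (tails I le) \<and>
     (\<forall>a\<in>I. best_response (k a) (s a))"

text \<open>HOL cannot quantify over the type of the index set, so it is fixed here. This is no
  restriction: by lemma \<open>perfectI_along\<close> below, nets over an arbitrary index type yield the same
  notion.\<close>

definition perfect :: "(nat \<Rightarrow> 'a set \<Rightarrow> real) \<Rightarrow> bool" where
  "perfect \<sigma> \<longleftrightarrow> \<sigma> \<in> profiles \<and>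
     (\<exists>(I :: ((nat \<Rightarrow> 'a set \<Rightarrow> real) set \<times> (nat \<Rightarrow> 'a set) set \<times> nat) set) le s k.
        perfect_along I le s k \<sigma>)"

definition perfect_equilibria :: "(nat \<Rightarrow> 'a set \<Rightarrow> real) set" where
  "perfect_equilibria = {\<sigma>. nash_equilibrium \<sigma> \<and> perfect \<sigma>}"

lemma perfectI_along:
  fixes I :: "'d set"
  assumes \<sigma>: "\<sigma> \<in> profiles" and along: "perfect_along I le s k \<sigma>"
  shows "perfect \<sigma>"
proof -
  note pa = along[unfolded perfect_along_def]
  have dir: "directed_set I le" and sI: "s ` I \<subseteq> profiles" and kI: "k ` I \<subseteq> profiles"
    and cm: "completely_mixed I le s"
    and ls: "limitin strategy_topology s \<sigma> (tails I le)"
    and lk: "limitin strategy_topology k \<sigma> (tails I le)"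
    and br: "\<forall>a\<in>I. best_response (k a) (s a)"
    using pa by auto
  have up: "\<exists>c\<in>I. le a c \<and> le b c" if "a \<in> I" "b \<in> I" for a b
    using dir that by (auto simp: directed_set_def)
  have tr: "le a c" if "le a b" "le b c" "a \<in> I" "b \<in> I" "c \<in> I" for a b c
    using dir that transp_onD[of I le a b c] by (auto simp: directed_set_def)
  let ?T = strategy_topology
  define J where "J = {V. openin ?T V \<and> \<sigma> \<in> V} \<times> carriers \<times> (UNIV :: nat set)"
  define leJ where "leJ = (\<lambda>(V :: (nat \<Rightarrow> 'a set \<Rightarrow> real) set, C :: (nat \<Rightarrow> 'a set) set, m :: nat) (V', C', m').
      V' \<subseteq> V \<and> C \<subseteq> C' \<and> m \<le> m')"
  have pick: "\<exists>a\<in>I. s a \<in> V \<and> k a \<in> V \<and> C \<subseteq> carrier_of (s a)"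
    if V: "openin ?T V" "\<sigma> \<in> V" and C: "C \<in> carriers" for V C
  proof -
    obtain a1 where a1: "a1 \<in> I" "\<forall>b\<in>I. le a1 b \<longrightarrow> s b \<in> V"
      using ls V unfolding limitin_def eventually_tails[OF dir] by blast
    obtain a2 where a2: "a2 \<in> I" "\<forall>b\<in>I. le a2 b \<longrightarrow> k b \<in> V"
      using lk V unfolding limitin_def eventually_tails[OF dir] by blast
    obtain a3 where a3: "a3 \<in> I" "\<forall>b\<in>I. le a3 b \<longrightarrow> C \<subseteq> carrier_of (s b)"
      using cm C unfolding completely_mixed_def by blast
    obtain b where b: "b \<in> I" "le a1 b" "le a2 b" using up[OF a1(1) a2(1)] by blast
    obtain c where c: "c \<in> I" "le b c" "le a3 c" using up[OF b(1) a3(1)] by blast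
    have 1: "le a1 c" by (rule tr[OF b(2) c(2) a1(1) b(1) c(1)])
    have 2: "le a2 c" by (rule tr[OF b(3) c(2) a2(1) b(1) c(1)])
    show ?thesis using a1(2) a2(2) a3(2) c(1,3) 1 2 by blast
  qed
  define \<alpha> where "\<alpha> = (\<lambda>(V, C, m :: nat). SOME a. a \<in> I \<and> s a \<in> V \<and> k a \<in> V \<and> C \<subseteq> carrier_of (s a))"
  have \<alpha>: "\<alpha> (V, C, m) \<in> I \<and> s (\<alpha> (V, C, m)) \<in> V \<and> k (\<alpha> (V, C, m)) \<in> V \<and>
      C \<subseteq> carrier_of (s (\<alpha> (V, C, m)))" if "(V, C, m) \<in> J" for V C m
    unfolding \<alpha>_def prod.case
    by (rule someI_ex) (use pick[of V C] that in \<open>auto simp: J_def\<close>)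
  have topo: "\<sigma> \<in> topspace ?T" using ls by (simp add: limitin_def)
  have J0: "(topspace ?T, carrier_of \<sigma>, 0) \<in> J"
    using topo \<sigma> by (auto simp: J_def carriers_def)
  have dirJ: "directed_set J leJ"
    unfolding directed_set_def
  proof (intro conjI ballI)
    show "J \<noteq> {}" using J0 by blast
    show "reflp_on J leJ" by (auto simp: reflp_on_def leJ_def)
    show "transp_on J leJ" by (auto simp: transp_on_def leJ_def)
  next
    fix x y assume "x \<in> J" "y \<in> J"
    then obtain V C m V' C' m' where xy: "x = (V, C, m)" "y = (V', C', m')"
      and J: "(V, C, m) \<in> J" "(V', C', m') \<in> J" by (cases x; cases y) auto
    obtain a where a: "a \<in> I" "\<forall>b\<in>I. le a b \<longrightarrow> C \<subseteq> carrier_of (s b)"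
      using cm J unfolding completely_mixed_def J_def by blast
    obtain a' where a': "a' \<in> I" "\<forall>b\<in>I. le a' b \<longrightarrow> C' \<subseteq> carrier_of (s b)"
      using cm J unfolding completely_mixed_def J_def by blast
    obtain c where c: "c \<in> I" "le a c" "le a' c" using up[OF a(1) a'(1)] by blast
    have "(V \<inter> V', carrier_of (s c), max m m') \<in> J"
      using J c(1) sI by (auto simp: J_def carriers_def)
    moreover have "leJ x (V \<inter> V', carrier_of (s c), max m m')"
      "leJ y (V \<inter> V', carrier_of (s c), max m m')"
      using a a' c by (auto simp: leJ_def xy)
    ultimately show "\<exists>z\<in>J. leJ x z \<and> leJ y z" by blast
  next
    fix x assume "x \<in> J"
    moreover obtain V C m where "x = (V, C, m)" by (cases x)
    ultimately have "(V, C, Suc m) \<in> J \<and> leJ x (V, C, Suc m) \<and> (V, C, Suc m) \<noteq> x"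
      by (auto simp: J_def leJ_def)
    then show "\<exists>y\<in>J. leJ x y \<and> y \<noteq> x" by blast
  qed
  have \<alpha>I: "\<alpha> x \<in> I" if "x \<in> J" for x using \<alpha> that by (cases x) blast
  have lim: "limitin ?T (f \<circ> \<alpha>) \<sigma> (tails J leJ)"
    if f: "\<And>V C m. (V, C, m) \<in> J \<Longrightarrow> f (\<alpha> (V, C, m)) \<in> V" for f
    unfolding limitin_def eventually_tails[OF dirJ]
  proof (intro conjI allI impI topo)
    fix U assume "openin ?T U \<and> \<sigma> \<in> U"
    then have "(U, carrier_of \<sigma>, 0) \<in> J" using J0 by (auto simp: J_def)
    moreover have "\<forall>y\<in>J. leJ (U, carrier_of \<sigma>, 0) y \<longrightarrow> (f \<circ> \<alpha>) y \<in> U"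
      using f by (auto simp: leJ_def)
    ultimately show "\<exists>x\<in>J. \<forall>y\<in>J. leJ x y \<longrightarrow> (f \<circ> \<alpha>) y \<in> U" by blast
  qed
  have cmJ: "completely_mixed J leJ (s \<circ> \<alpha>)"
    unfolding completely_mixed_def
  proof
    fix C assume "C \<in> carriers"
    then have "(topspace ?T, C, 0) \<in> J" using J0 by (auto simp: J_def)
    moreover have "\<forall>y\<in>J. leJ (topspace ?T, C, 0) y \<longrightarrow> C \<subseteq> carrier_of ((s \<circ> \<alpha>) y)"
    proof (intro ballI impI)
      fix y assume y: "y \<in> J" "leJ (topspace ?T, C, 0) y"
      obtain V C' m where yy: "y = (V, C', m)" by (cases y)
      have "C \<subseteq> C'" using y(2) by (simp add: leJ_def yy)
      also have "C' \<subseteq> carrier_of (s (\<alpha> y))" using \<alpha> y(1) yy by blast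
      finally show "C \<subseteq> carrier_of ((s \<circ> \<alpha>) y)" by simp
    qed
    ultimately show "\<exists>x\<in>J. \<forall>y\<in>J. leJ x y \<longrightarrow> C \<subseteq> carrier_of ((s \<circ> \<alpha>) y)" by blast
  qed
  have "perfect_along J leJ (s \<circ> \<alpha>) (k \<circ> \<alpha>) \<sigma>"
    unfolding perfect_along_def
    using dirJ cmJ lim[of s] lim[of k] \<alpha> \<alpha>I sI kI br by auto
  then show ?thesis unfolding perfect_def using \<sigma> by blast
qed

end

end

(*
  Each expected payoff is a uniform limit of combinations of rectangle masses, hence continuous
  on the compact space of profiles and affine in the player's own strategy. For a profile s and a
  weight e > 0, Ky Fan's inequality (from Brouwer's theorem on a simplex) therefore gives a
  profile k that is a best response to (1 - e) k + e s, and this mixture has a carrier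
  containing that of s. Letting e tend to 0, a cluster point of the profiles k is approximated by
  pairs (mixture, best response) with carrier containing that of s. Perfection means being
  approximable in this way for every carrier. For each carrier this describes a non-empty closed
  set, and carriers are directed under inclusion, so compactness makes the intersection non-empty
  and compact. Continuity of payoffs turns perfection into the Nash property.
*)

theory Submission
  imports Defs
begin

text \<open>On an uncountable action set no charge is positive on every singleton, so in general no
  profile has a carrier containing all others. This is why the argument works with one carrier at a
  time. Cluster points and neighbourhoods replace convergent sequences because the space of charges
  is compact but need not be sequentially compact: think of the point masses on a countable set with
  the field of all subsets.

  Ky Fan's inequality asks for continuity in one variable and affinity in the other, so the charges
  are not embedded in a locally convex space; convex combinations enter as an abstract map.
  Deviations range over all strategies, and only the profile that they are measured against is
  perturbed. Hence the profile found is an unconstrained best response, as perfection requires.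

  The dimension in Brouwer's theorem is the number of profiles in a finite intersection, which is
  not known in advance. The cubes and simplices therefore live in
  \<open>nat \<Rightarrow> real\<close>.\<close>

section \<open>A fixed point theorem on the simplex\<close>

text \<open>The coordinates from \<open>m\<close> on are pinned to 0, so the dimension is a term
  rather than a type, and compactness is Tychonoff's theorem.\<close>

definition nat_cube :: "nat \<Rightarrow> (nat \<Rightarrow> real) set" where
  "nat_cube m = (\<Pi>\<^sub>E i\<in>UNIV. if i < m then {0..1} else {0})"

lemma mem_nat_cube: "x \<in> nat_cube m \<longleftrightarrow> (\<forall>i<m. 0 \<le> x i \<and> x i \<le> 1) \<and> (\<forall>i\<ge>m. x i = 0)"
  by (force simp: nat_cube_def PiE_iff split: if_splits)

lemma compact_PiE_UNIV:
  fixes S :: "'i \<Rightarrow> 'b::topological_space set"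
  assumes "\<And>i. compact (S i)"
  shows "compact (Pi\<^sub>E UNIV S)"
proof -
  have "compactin (product_topology (\<lambda>i. euclidean) UNIV) (Pi\<^sub>E UNIV S)"
    using assms by (simp add: compactin_PiE)
  then show ?thesis
    by (simp add: euclidean_product_topology)
qed

lemma compact_nat_cube: "compact (nat_cube m)"
  unfolding nat_cube_def by (intro compact_PiE_UNIV) auto

text \<open>Kuhn's argument. Label 0 in coordinate \<open>i\<close> means that \<open>f\<close> does
  not lower this coordinate, label 1 that it does not raise it. On each grid the combinatorial lemma
  finds a cell showing both labels in every coordinate. As the mesh tends to 0 the cells accumulate
  at a point, where both inequalities survive.\<close>

theorem brouwer_nat_cube:
  fixes f :: "(nat \<Rightarrow> real) \<Rightarrow> nat \<Rightarrow> real"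
  assumes contf: "continuous_on (nat_cube m) f" and maps: "f \<in> nat_cube m \<rightarrow> nat_cube m"
  shows "\<exists>x\<in>nat_cube m. f x = x"
proof -
  let ?K = "nat_cube m"
  have "\<exists>l. (\<forall>x i. l x i \<le> (1::nat)) \<and>
             (\<forall>x i. x \<in> ?K \<and> i < m \<and> x i = 0 \<longrightarrow> l x i = 0) \<and>
             (\<forall>x i. x \<in> ?K \<and> i < m \<and> x i = 1 \<longrightarrow> l x i = 1) \<and>
             (\<forall>x i. x \<in> ?K \<and> i < m \<and> l x i = 0 \<longrightarrow> x i \<le> f x i) \<and>
             (\<forall>x i. x \<in> ?K \<and> i < m \<and> l x i = 1 \<longrightarrow> f x i \<le> x i)"
  proof (rule kuhn_labelling_lemma'[of "\<lambda>x. x \<in> ?K" f "\<lambda>i. i < m"])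
    show "\<forall>x. x \<in> ?K \<longrightarrow> f x \<in> ?K" using maps by blast
    show "\<forall>x. x \<in> ?K \<longrightarrow> (\<forall>i<m. 0 \<le> x i \<and> x i \<le> 1)" by (simp add: mem_nat_cube)
  qed
  then obtain l :: "(nat \<Rightarrow> real) \<Rightarrow> nat \<Rightarrow> nat" where
        l_le: "\<And>x i. l x i \<le> 1"
    and l0: "\<And>x i. x \<in> ?K \<Longrightarrow> i < m \<Longrightarrow> x i = 0 \<Longrightarrow> l x i = 0"
    and l1: "\<And>x i. x \<in> ?K \<Longrightarrow> i < m \<Longrightarrow> x i = 1 \<Longrightarrow> l x i = 1"
    and lab0: "\<And>x i. x \<in> ?K \<Longrightarrow> i < m \<Longrightarrow> l x i = 0 \<Longrightarrow> x i \<le> f x i"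
    and lab1: "\<And>x i. x \<in> ?K \<Longrightarrow> i < m \<Longrightarrow> l x i = 1 \<Longrightarrow> f x i \<le> x i"
    by blast
  \<comment> \<open>\<open>pt p q\<close> is the grid point with integer coordinates
    \<open>q\<close> and mesh \<open>1 / Suc p\<close>; \<open>Suc\<close> keeps the mesh defined at
    \<open>p = 0\<close>. Below, \<open>near q r\<close> says that \<open>r\<close> is a vertex of
    the cell with lowest corner \<open>q\<close>.\<close>
  define pt where "pt = (\<lambda>(p::nat) (q::nat \<Rightarrow> nat) i. if i < m then real (q i) / real (Suc p) else 0)"
  have pt_cube: "pt p q \<in> ?K" if "\<forall>i<m. q i \<le> Suc p" for p q
    using that by (auto simp: pt_def mem_nat_cube divide_le_eq_1)
  define near where "near = (\<lambda>(q::nat \<Rightarrow> nat) r. \<forall>j<m. q j \<le> r j \<and> r j \<le> q j + 1)"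
  define P where "P = (\<lambda>p q a b. (\<forall>i<m. q i < Suc p) \<and>
     (\<forall>i<m. near q (a i) \<and> near q (b i) \<and> l (pt p (a i)) i = 0 \<and> l (pt p (b i)) i = 1))"
  have step: "\<exists>q a b. P p q a b" for p
  proof -
    let ?l = "\<lambda>q i. l (pt p q) i"
    have ab01: "?l x i = 0 \<or> ?l x i = 1" for x i
      using l_le[of "pt p x" i] by linarith
    have "\<exists>q. (\<forall>i<m. q i < Suc p) \<and> (\<forall>i<m. \<exists>r s. near q r \<and> near q s \<and> ?l r i \<noteq> ?l s i)"
    proof (rule kuhn_lemma[of "Suc p" m ?l])
      show "\<forall>x. (\<forall>i<m. x i \<le> Suc p) \<longrightarrow> (\<forall>i<m. ?l x i = 0 \<or> ?l x i = 1)"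
        using ab01 by blast
      show "\<forall>x. (\<forall>i<m. x i \<le> Suc p) \<longrightarrow> (\<forall>i<m. x i = 0 \<longrightarrow> ?l x i = 0)"
        by (intro allI impI l0 pt_cube) (auto simp: pt_def)
      show "\<forall>x. (\<forall>i<m. x i \<le> Suc p) \<longrightarrow> (\<forall>i<m. x i = Suc p \<longrightarrow> ?l x i = 1)"
        by (intro allI impI l1 pt_cube) (auto simp: pt_def)
    next
      fix q assume "\<forall>i<m. q i < Suc p"
        "\<forall>i<m. \<exists>r s. (\<forall>j<m. q j \<le> r j \<and> r j \<le> q j + 1) \<and>
          (\<forall>j<m. q j \<le> s j \<and> s j \<le> q j + 1) \<and> ?l r i \<noteq> ?l s i"
      then show ?thesis unfolding near_def by blast
    qed simp
    then obtain q where q: "\<forall>i<m. q i < Suc p"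
      and rs: "\<And>i. i < m \<Longrightarrow> \<exists>r s. near q r \<and> near q s \<and> ?l r i \<noteq> ?l s i"
      by blast
    have "\<exists>a b. near q a \<and> near q b \<and> ?l a i = 0 \<and> ?l b i = 1" if i: "i < m" for i
    proof -
      obtain r s where rs: "near q r" "near q s" "?l r i \<noteq> ?l s i" using rs[OF i] by blast
      show ?thesis
      proof (cases "?l r i = 0")
        case True
        then have "?l s i = 1" using rs(3) ab01[of s i] by simp
        with True rs show ?thesis by blast
      next
        case False
        then have "?l s i = 0" "?l r i = 1" using rs(3) ab01[of s i] ab01[of r i] by simp_all
        with rs show ?thesis by blast
      qed
    qed
    then have "\<exists>a b. \<forall>i<m. near q (a i) \<and> near q (b i) \<and> ?l (a i) i = 0 \<and> ?l (b i) i = 1"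
      by metis
    then show ?thesis using q unfolding P_def by blast
  qed
  obtain q a b where q: "\<And>p i. i < m \<Longrightarrow> q p i < Suc p"
    and ab: "\<And>p i. i < m \<Longrightarrow> near (q p) (a p i)" "\<And>p i. i < m \<Longrightarrow> near (q p) (b p i)"
      "\<And>p i. i < m \<Longrightarrow> l (pt p (a p i)) i = 0" "\<And>p i. i < m \<Longrightarrow> l (pt p (b p i)) i = 1"
  proof -
    have "\<forall>p. \<exists>q a b. P p q a b" using step by blast
    from choice[OF this] obtain q where "\<forall>p. \<exists>a b. P p (q p) a b" by blast
    from choice[OF this] obtain a where "\<forall>p. \<exists>b. P p (q p) (a p) b" by blast
    from choice[OF this] obtain b where "\<forall>p. P p (q p) (a p) (b p)" by blast
    then show ?thesis using that unfolding P_def by blast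
  qed
  have "\<forall>p. pt p (q p) \<in> ?K" using q by (intro allI pt_cube) (auto simp: less_imp_le)
  then obtain z h where z: "z \<in> ?K" and h: "strict_mono h"
    and lim: "((\<lambda>p. pt p (q p)) \<circ> h) \<longlonglongrightarrow> z"
    using compact_nat_cube[of m] unfolding compact_eq_seq_compact_metric by (auto elim!: seq_compactE)
  \<comment> \<open>Every vertex of a cell lies within one mesh width of its lowest corner in each
    coordinate, so all choices of vertices converge to the same \<open>z\<close>.\<close>
  have limr: "(\<lambda>p. pt (h p) (r (h p))) \<longlonglongrightarrow> z" "pt p (r p) \<in> ?K"
    if r: "\<And>p. near (q p) (r p)" for r p
  proof -
    have "r p i \<le> Suc p" if "i < m" for i
      using r[of p] q[OF that, of p] that unfolding near_def by fastforce
    then show "pt p (r p) \<in> ?K" by (intro pt_cube) auto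
    have "(\<lambda>p. pt (h p) (r (h p)) i) \<longlonglongrightarrow> z i" for i
    proof (cases "i < m")
      case True
      have qi: "(\<lambda>p. pt (h p) (q (h p)) i) \<longlonglongrightarrow> z i"
        using continuous_on_tendsto_compose[OF continuous_on_product_coordinates[of i] lim]
        by (simp add: o_def)
      have "(\<lambda>p. pt (h p) (r (h p)) i - pt (h p) (q (h p)) i) \<longlonglongrightarrow> 0"
      proof (rule Lim_null_comparison)
        show "(\<lambda>p. 1 / real (Suc (h p))) \<longlonglongrightarrow> 0"
          using LIMSEQ_subseq_LIMSEQ[OF LIMSEQ_inverse_real_of_nat h]
          by (simp add: o_def inverse_eq_divide)
        have "\<bar>pt p (r p) i - pt p (q p) i\<bar> \<le> 1 / real (Suc p)" for p
        proof -
          have "q p i \<le> r p i" "r p i \<le> q p i + 1" using r[of p] True by (auto simp: near_def)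
          then have "\<bar>real (r p i) - real (q p i)\<bar> \<le> 1" by linarith
          then show ?thesis using True
            by (simp add: pt_def diff_divide_distrib[symmetric] divide_right_mono)
        qed
        then show "\<forall>\<^sub>F p in sequentially. norm (pt (h p) (r (h p)) i - pt (h p) (q (h p)) i)
            \<le> 1 / real (Suc (h p))"
          by simp
      qed
      from tendsto_add[OF this qi] show ?thesis by simp
    next
      case False
      then show ?thesis using z by (simp add: pt_def mem_nat_cube)
    qed
    then show "(\<lambda>p. pt (h p) (r (h p))) \<longlonglongrightarrow> z"
      using limitin_componentwise[of "\<lambda>_. euclidean" UNIV "\<lambda>p. pt (h p) (r (h p))" z sequentially]
      by (simp add: euclidean_product_topology)
  qed
  have limf: "(\<lambda>p. f (pt (h p) (r (h p))) i) \<longlonglongrightarrow> f z i"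
    "(\<lambda>p. pt (h p) (r (h p)) i) \<longlonglongrightarrow> z i"
    if r: "\<And>p. near (q p) (r p)" for r i
  proof -
    have "continuous_on ?K (\<lambda>x. f x i)"
      using contf by (rule continuous_on_product_then_coordinatewise)
    then show "(\<lambda>p. f (pt (h p) (r (h p))) i) \<longlonglongrightarrow> f z i"
      by (rule continuous_on_tendsto_compose) (use limr[of r] r z in auto)
    show "(\<lambda>p. pt (h p) (r (h p)) i) \<longlonglongrightarrow> z i"
      using continuous_on_tendsto_compose[OF continuous_on_product_coordinates[of i] limr(1)] r
      by simp
  qed
  have "f z i = z i" for i
  proof (cases "i < m")
    case True
    \<comment> \<open>The vertices \<open>a p i\<close> carry label 0 in coordinate \<open>i\<close>
      and give the lower bound for \<open>f z i\<close>; the vertices \<open>b p i\<close> carry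
      label 1 and give the upper bound.\<close>
    have a: "near (q p) (a p i)" and b: "near (q p) (b p i)" for p using ab True by auto
    have "z i \<le> f z i"
      by (rule LIMSEQ_le[OF limf(2)[of "\<lambda>p. a p i"] limf(1)[of "\<lambda>p. a p i"]])
        (use a ab(3) limr(2)[of "\<lambda>p. a p i"] True lab0 in auto)
    moreover have "f z i \<le> z i"
      by (rule LIMSEQ_le[OF limf(1)[of "\<lambda>p. b p i"] limf(2)[of "\<lambda>p. b p i"]])
        (use b ab(4) limr(2)[of "\<lambda>p. b p i"] True lab1 in auto)
    ultimately show ?thesis by simp
  next
    case False
    have "f z \<in> ?K" using maps z by auto
    then show ?thesis using False z by (simp add: mem_nat_cube)
  qed
  then show ?thesis using z by auto
qed

section \<open>Brouwer's theorem and Nash's map on the simplex\<close>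

definition prob_simplex :: "nat \<Rightarrow> (nat \<Rightarrow> real) set" where
  "prob_simplex m = {x. (\<forall>k<m. 0 \<le> x k) \<and> (\<forall>k\<ge>m. x k = 0) \<and> (\<Sum>k<m. x k) = 1}"

lemma simplex_subset_nat_cube: "prob_simplex m \<subseteq> nat_cube m"
proof
  fix x assume x: "x \<in> prob_simplex m"
  have "x k \<le> 1" if "k < m" for k
    using member_le_sum[of k "{..<m}" x] x that by (auto simp: prob_simplex_def)
  then show "x \<in> nat_cube m" using x by (auto simp: prob_simplex_def mem_nat_cube)
qed

lemma simplex_normalize:
  assumes "\<And>k. k < m \<Longrightarrow> 0 \<le> y k" "0 < (\<Sum>k<m. y k)"
  shows "(\<lambda>k. if k < m then y k / (\<Sum>k<m. y k) else 0) \<in> prob_simplex m"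
  using assms by (auto simp: prob_simplex_def sum_divide_distrib[symmetric])

text \<open>The map \<open>x \<mapsto> x + max 0 (1 - \<Sum>x) / m\<close>, normalised, retracts the cube onto the simplex.\<close>

theorem brouwer_simplex:
  fixes f :: "(nat \<Rightarrow> real) \<Rightarrow> nat \<Rightarrow> real"
  assumes m: "0 < m" and contf: "continuous_on (prob_simplex m) f"
    and maps: "f \<in> prob_simplex m \<rightarrow> prob_simplex m"
  shows "\<exists>x\<in>prob_simplex m. f x = x"
proof -
  define y where "y = (\<lambda>(x::nat \<Rightarrow> real) k. x k + max 0 (1 - (\<Sum>j<m. x j)) / m)"
  define r where "r = (\<lambda>x k. if k < m then y x k / (\<Sum>k<m. y x k) else 0)"
  \<comment> \<open>The correction lifts a total below 1 to exactly 1 and leaves larger totals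
    alone. The denominator of \<open>r\<close> is thus at least 1, which makes \<open>r\<close>
    continuous.\<close>
  have sum_y: "(\<Sum>k<m. y x k) = max 1 (\<Sum>k<m. x k)" for x
    using m by (simp add: y_def sum.distrib)
  have r_simplex: "r x \<in> prob_simplex m" if "x \<in> nat_cube m" for x
    unfolding r_def
  proof (rule simplex_normalize)
    show "0 \<le> y x k" if "k < m" for k
      using that \<open>x \<in> nat_cube m\<close> by (auto simp: mem_nat_cube y_def)
  qed (simp add: sum_y)
  have r_id: "r x = x" if "x \<in> prob_simplex m" for x
    using that unfolding r_def sum_y by (auto simp: y_def prob_simplex_def)
  have contr: "continuous_on (nat_cube m) r"
  proof (rule continuous_on_coordinatewise_then_product)
    fix k
    have "max 1 t \<noteq> 0" for t :: real by linarith
    then show "continuous_on (nat_cube m) (\<lambda>x. r x k)"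
      unfolding r_def sum_y unfolding y_def
      by (cases "k < m") (auto intro!: continuous_intros continuous_on_subset[OF continuous_on_product_coordinates])
  qed
  have "continuous_on (nat_cube m) (\<lambda>x. f (r x))"
    by (rule continuous_on_compose2[OF contf contr]) (use r_simplex in auto)
  moreover have "(\<lambda>x. f (r x)) \<in> nat_cube m \<rightarrow> nat_cube m"
    using maps r_simplex simplex_subset_nat_cube by blast
  ultimately obtain x where x: "x \<in> nat_cube m" "f (r x) = x"
    using brouwer_nat_cube by blast
  \<comment> \<open>A fixed point of \<open>f\<close> after \<open>r\<close> is a value of
    \<open>f\<close>, hence in the simplex, where \<open>r\<close> is the identity.\<close>
  have "x \<in> prob_simplex m" using maps r_simplex[OF x(1)] x(2) by (metis Pi_mem)
  then show ?thesis using x(2) r_id by auto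
qed

text \<open>Nash's map: each coordinate is increased by the positive part of its gain.\<close>

lemma simplex_nonpositive_gains:
  fixes g :: "(nat \<Rightarrow> real) \<Rightarrow> nat \<Rightarrow> real"
  assumes m: "0 < m" and contg: "\<And>k. k < m \<Longrightarrow> continuous_on (prob_simplex m) (\<lambda>x. g x k)"
    and avg: "\<And>x. x \<in> prob_simplex m \<Longrightarrow> (\<Sum>k<m. x k * g x k) \<le> 0"
  shows "\<exists>x\<in>prob_simplex m. \<forall>k<m. g x k \<le> 0"
proof -
  define y where "y = (\<lambda>(x::nat \<Rightarrow> real) k. x k + max 0 (g x k))"
  define f where "f = (\<lambda>x k. if k < m then y x k / (\<Sum>k<m. y x k) else 0)"
  have sum_y: "(\<Sum>k<m. y x k) = 1 + (\<Sum>k<m. max 0 (g x k))" if "x \<in> prob_simplex m" for x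
    using that by (simp add: y_def sum.distrib prob_simplex_def)
  have pos: "1 \<le> (\<Sum>k<m. y x k)" if "x \<in> prob_simplex m" for x
    unfolding sum_y[OF that] by (simp add: sum_nonneg)
  have maps: "f \<in> prob_simplex m \<rightarrow> prob_simplex m"
  proof
    fix x assume x: "x \<in> prob_simplex m"
    show "f x \<in> prob_simplex m"
      unfolding f_def
      by (rule simplex_normalize) (use x pos[OF x] in \<open>auto simp: y_def prob_simplex_def\<close>)
  qed
  have contf: "continuous_on (prob_simplex m) f"
  proof (rule continuous_on_coordinatewise_then_product)
    fix k
    have "continuous_on (prob_simplex m) (\<lambda>x. y x k)" if "k < m" for k
      unfolding y_def
      by (intro continuous_intros contg that continuous_on_subset[OF continuous_on_product_coordinates]) auto
    moreover have "(\<Sum>k<m. y x k) \<noteq> 0" if "x \<in> prob_simplex m" for x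
      using pos[OF that] by linarith
    ultimately show "continuous_on (prob_simplex m) (\<lambda>x. f x k)"
      unfolding f_def by (cases "k < m") (auto intro!: continuous_intros)
  qed
  obtain x where x: "x \<in> prob_simplex m" and fx: "f x = x"
    using brouwer_simplex[OF m contf maps] by blast
  define S where "S = (\<Sum>k<m. max 0 (g x k))"
  have fixed: "x k * S = max 0 (g x k)" if k: "k < m" for k
  proof -
    have "x k = y x k / (\<Sum>k<m. y x k)" using fun_cong[OF fx, of k] k by (simp add: f_def)
    then have "x k * (1 + S) = y x k"
      using pos[OF x] unfolding sum_y[OF x] S_def by (simp add: field_simps)
    then show ?thesis by (simp add: y_def algebra_simps)
  qed
  \<comment> \<open>If \<open>S\<close> were positive, the weights \<open>x k\<close> would be the
    positive parts divided by \<open>S\<close>. The average gain would then be the sum of their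
    squares over \<open>S\<close>, which \<open>avg\<close> forces to be 0.\<close>
  have "S = 0"
  proof (rule ccontr)
    assume "S \<noteq> 0"
    then have S: "S > 0" using sum_nonneg[of "{..<m}" "\<lambda>k. max 0 (g x k)"] by (simp add: S_def)
    have "(\<Sum>k<m. max 0 (g x k) * g x k) = S * (\<Sum>k<m. x k * g x k)"
      unfolding sum_distrib_left by (rule sum.cong) (auto simp: fixed[symmetric])
    also have "\<dots> \<le> 0" using avg[OF x] S by (simp add: mult_nonneg_nonpos)
    finally have "(\<Sum>k<m. max 0 (g x k) * g x k) \<le> 0" .
    moreover have nn: "0 \<le> max 0 (g x k) * g x k" for k by (auto simp: max_def)
    ultimately have "(\<Sum>k<m. max 0 (g x k) * g x k) = 0"
      by (meson nle_le sum_nonneg)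
    then have "\<forall>k\<in>{..<m}. max 0 (g x k) * g x k = 0"
      using nn by (subst (asm) sum_nonneg_eq_0_iff) auto
    then have "\<forall>k\<in>{..<m}. max 0 (g x k) = 0" by (force simp: max_def)
    then have "S = 0" by (simp add: S_def)
    with \<open>S \<noteq> 0\<close> show False by simp
  qed
  have "g x k \<le> 0" if "k < m" for k
    using fixed[OF that] \<open>S = 0\<close> by (simp add: max_def split: if_splits)
  then show ?thesis using x by blast
qed

text \<open>By compactness it is enough to treat finitely many \<open>t\<close>. Among mixtures of
  these, take as gain of \<open>t k\<close> the value of \<phi> at the mixture and
  \<open>t k\<close>. By affinity the average gain is the value of \<phi> on the diagonal, so it is
  at most 0 and \<open>simplex_nonpositive_gains\<close> applies. The map \<open>mix\<close> stands
  for convex combination, so that \<open>K\<close> needs no linear structure.\<close>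

theorem ky_fan:
  fixes K :: "'b::topological_space set" and mix :: "nat \<Rightarrow> (nat \<Rightarrow> real) \<Rightarrow> (nat \<Rightarrow> 'b) \<Rightarrow> 'b"
    and \<phi> :: "'b \<Rightarrow> 'b \<Rightarrow> real"
  assumes K: "compact K" "K \<noteq> {}"
    and mix_in: "\<And>m x t. x \<in> prob_simplex m \<Longrightarrow> (\<And>k. k < m \<Longrightarrow> t k \<in> K) \<Longrightarrow> mix m x t \<in> K"
    and mix_cont: "\<And>m t. (\<And>k. k < m \<Longrightarrow> t k \<in> K) \<Longrightarrow> continuous_on (prob_simplex m) (\<lambda>x. mix m x t)"
    and cont: "\<And>t. t \<in> K \<Longrightarrow> continuous_on K (\<lambda>s. \<phi> s t)"
    and affine: "\<And>m x t s. x \<in> prob_simplex m \<Longrightarrow> (\<And>k. k < m \<Longrightarrow> t k \<in> K) \<Longrightarrow> s \<in> K \<Longrightarrow>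
      \<phi> s (mix m x t) = (\<Sum>k<m. x k * \<phi> s (t k))"
    and diag: "\<And>s. s \<in> K \<Longrightarrow> \<phi> s s \<le> 0"
  shows "\<exists>s\<in>K. \<forall>t\<in>K. \<phi> s t \<le> 0"
proof -
  have closed_ex: "\<exists>C. closed C \<and> {s\<in>K. \<phi> s t \<le> 0} = C \<inter> K" if "t \<in> K" for t
    using continuous_closedin_preimage[OF cont[OF that] closed_atMost[of 0]]
    unfolding closedin_closed by (auto simp: vimage_def)
  \<comment> \<open>Continuity on \<open>K\<close> gives sets closed relative to \<open>K\<close>;
    \<open>C t\<close> is a closed set of the whole space with the same trace, as the finite
    intersection property expects.\<close>
  then obtain C where C: "\<And>t. t \<in> K \<Longrightarrow> closed (C t)"
    "\<And>t. t \<in> K \<Longrightarrow> {s\<in>K. \<phi> s t \<le> 0} = C t \<inter> K" by metis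
  have fin: "K \<inter> \<Inter>(C ` T) \<noteq> {}" if T: "finite T" "T \<subseteq> K" for T
  proof (cases "T = {}")
    case False
    obtain t where "bij_betw t {0..<card T} T" using T(1) ex_bij_betw_nat_finite by blast
    then have "t ` {0..<card T} = T" by (simp add: bij_betw_def)
    then have tT: "\<And>k. k < card T \<Longrightarrow> t k \<in> T"
      and tE: "\<And>s. s \<in> T \<Longrightarrow> \<exists>k<card T. s = t k" by force+
    let ?m = "card T"
    have m: "?m > 0" using False T by (simp add: card_gt_0_iff)
    have tK: "t k \<in> K" if "k < ?m" for k using tT[OF that] T(2) by blast
    have "\<exists>x\<in>prob_simplex ?m. \<forall>k<?m. \<phi> (mix ?m x t) (t k) \<le> 0"
    proof (rule simplex_nonpositive_gains[OF m])
      fix k assume "k < ?m"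
      show "continuous_on (prob_simplex ?m) (\<lambda>x. \<phi> (mix ?m x t) (t k))"
        by (rule continuous_on_compose2[OF cont[OF tK[OF \<open>k < ?m\<close>]] mix_cont[OF tK]])
          (use mix_in tK in auto)
    next
      fix x assume x: "x \<in> prob_simplex ?m"
      show "(\<Sum>k<?m. x k * \<phi> (mix ?m x t) (t k)) \<le> 0"
      proof -
        have "mix ?m x t \<in> K" using x tK by (rule mix_in)
        then show ?thesis using diag[of "mix ?m x t"] affine[of x ?m t "mix ?m x t"] x tK by simp
      qed
    qed
    then obtain x where x: "x \<in> prob_simplex ?m" "\<And>k. k < ?m \<Longrightarrow> \<phi> (mix ?m x t) (t k) \<le> 0" by blast
    have "mix ?m x t \<in> C s" if "s \<in> T" for s
    proof -
      obtain k where k: "k < ?m" "s = t k" using tE[OF \<open>s \<in> T\<close>] by blast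
      then have "mix ?m x t \<in> {s'\<in>K. \<phi> s' s \<le> 0}" using x(2) mix_in[of x ?m t, OF x(1) tK] by simp
      moreover have "s \<in> K" using T(2) that by blast
      ultimately show ?thesis by (simp add: C(2))
    qed
    then show ?thesis using mix_in[of x ?m t, OF x(1) tK] by blast
  qed (use K in auto)
  have "K \<inter> \<Inter>(C ` K) \<noteq> {}"
    by (rule compact_imp_fip_image[OF K(1)]) (use C fin in auto)
  then obtain s where s: "s \<in> K" "\<And>t. t \<in> K \<Longrightarrow> s \<in> C t" by blast
  have "\<phi> s t \<le> 0" if "t \<in> K" for t
  proof -
    have "s \<in> C t \<inter> K" using s that by simp
    then show ?thesis unfolding C(2)[OF that, symmetric] by simp
  qed
  then show ?thesis using s(1) by blast
qed

section \<open>Integration of simple functions\<close>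

text \<open>Positivity of the integral without refining the sets \<open>R l\<close> to a partition.
  Remove one set \<open>R q\<close> at a time and split \<open>E\<close> along it: inside, the
  remaining sum is at least \<open>d - c q\<close>; outside, at least \<open>d\<close>. Both
  \<open>E\<close> and \<open>d\<close> must therefore vary in the induction.\<close>

lemma additive_sum_ge:
  fixes \<mu> :: "'a set \<Rightarrow> real"
  assumes alg: "algebra \<Omega> M" and add: "additive M \<mu>" and nn: "\<And>E. E \<in> M \<Longrightarrow> 0 \<le> \<mu> E"
    and L: "finite L" "\<And>l. l \<in> L \<Longrightarrow> R l \<in> M" and E: "E \<in> M"
    and le: "\<And>x. x \<in> E \<Longrightarrow> d \<le> (\<Sum>l\<in>L. c l * indicator (R l) x)"
  shows "d * \<mu> E \<le> (\<Sum>l\<in>L. c l * \<mu> (R l \<inter> E))"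
  using L E le
proof (induction L arbitrary: E d rule: finite_induct)
  case empty
  show ?case
  proof (cases "E = {}")
    case True
    have "\<mu> ({} \<union> {}) = \<mu> {} + \<mu> {}"
      using additiveD[OF add, of "{}" "{}"] algebra_iff_Un[THEN iffD1, OF alg] by auto
    with True show ?thesis by simp
  next
    case False
    then have "d \<le> 0" using empty by auto
    then show ?thesis using nn[OF empty(2)] by (simp add: mult_nonpos_nonneg)
  qed
next
  case (insert q L)
  interpret algebra \<Omega> M by (rule alg)
  let ?T = "R q"
  have T: "?T \<in> M" and R: "\<And>l. l \<in> L \<Longrightarrow> R l \<in> M" using insert.prems by auto
  have split: "\<mu> X = \<mu> (X \<inter> ?T) + \<mu> (X - ?T)" if "X \<in> M" for X
  proof -
    have "\<mu> ((X \<inter> ?T) \<union> (X - ?T)) = \<mu> (X \<inter> ?T) + \<mu> (X - ?T)"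
      by (rule additiveD[OF add]) (use that T in auto)
    then show ?thesis by (simp add: Int_Diff_Un)
  qed
  have "(d - c q) * \<mu> (E \<inter> ?T) \<le> (\<Sum>l\<in>L. c l * \<mu> (R l \<inter> (E \<inter> ?T)))"
  proof (rule insert.IH)
    fix x assume "x \<in> E \<inter> ?T"
    then show "d - c q \<le> (\<Sum>l\<in>L. c l * indicator (R l) x)"
      using insert.prems(3)[of x] insert.hyps by (simp del: sum_mult_indicator)
  qed (use R T insert.prems in auto)
  moreover have "d * \<mu> (E - ?T) \<le> (\<Sum>l\<in>L. c l * \<mu> (R l \<inter> (E - ?T)))"
  proof (rule insert.IH)
    fix x assume "x \<in> E - ?T"
    then show "d \<le> (\<Sum>l\<in>L. c l * indicator (R l) x)"
      using insert.prems(3)[of x] insert.hyps by (simp del: sum_mult_indicator)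
  qed (use R T insert.prems in auto)
  moreover have "(\<Sum>l\<in>L. c l * \<mu> (R l \<inter> E)) =
      (\<Sum>l\<in>L. c l * \<mu> (R l \<inter> (E \<inter> ?T))) + (\<Sum>l\<in>L. c l * \<mu> (R l \<inter> (E - ?T)))"
    unfolding sum.distrib[symmetric]
  proof (rule sum.cong)
    fix l assume "l \<in> L"
    then have "R l \<inter> E \<in> M" using R insert.prems by blast
    from split[OF this] show "c l * \<mu> (R l \<inter> E) =
        c l * \<mu> (R l \<inter> (E \<inter> ?T)) + c l * \<mu> (R l \<inter> (E - ?T))"
      by (simp add: Int_assoc Int_Diff distrib_left)
  qed simp
  ultimately show ?case
    using insert.hyps split[OF insert.prems(2)] by (simp add: algebra_simps Int_commute)
qed

section \<open>Simple functions integrated against profiles\<close>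

context strategy_fields
begin

lemma profilesD:
  assumes "\<kappa> \<in> profiles" "i \<in> players"
  shows "\<kappa> i \<in> strategies i" "additive (F i) (\<kappa> i)" "\<kappa> i (A i) = 1"
    "\<And>E. E \<in> F i \<Longrightarrow> 0 \<le> \<kappa> i E"
  using assms by (auto simp: profiles_def strategies_def charges_def PiE_iff)

lemma action_profiles_nonempty: "action_profiles \<noteq> {}"
  using actions_nonempty by (auto simp: PiE_eq_empty_iff)

lemma action_in_field: "i \<in> players \<Longrightarrow> A i \<in> F i"
  by (rule algebra.top[OF field_of_sets])

lemma field_subset: "i \<in> players \<Longrightarrow> E \<in> F i \<Longrightarrow> E \<subseteq> A i"
  using algebra_iff_Un[THEN iffD1, OF field_of_sets[of i]] by blast

lemma indicator_rectangle:
  assumes "a \<in> action_profiles"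
  shows "indicator (Pi\<^sub>E players R) a = (\<Prod>i\<in>players. indicator (R i) (a i) :: real)"
proof (cases "a \<in> Pi\<^sub>E players R")
  case True
  then have "\<And>i. i \<in> players \<Longrightarrow> a i \<in> R i" by blast
  with True show ?thesis by simp
next
  case False
  then obtain i where "i \<in> players" "a i \<notin> R i" using assms by (auto simp: PiE_iff)
  then have "\<exists>i\<in>players. indicator (R i) (a i) = (0 :: real)" by (intro bexI[of _ i]) simp_all
  then have "(\<Prod>i\<in>players. indicator (R i) (a i)) = (0 :: real)"
    by (subst prod_zero_iff) auto
  with False show ?thesis by (simp del: One_nat_def)
qed

text \<open>Integrate out one player at a time.\<close>

lemma rect_sum_nonneg:
  assumes \<kappa>: "\<kappa> \<in> profiles" and L: "finite L" "\<And>l. l \<in> L \<Longrightarrow> R l \<in> sides"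
    and nonneg: "\<And>a. a \<in> action_profiles \<Longrightarrow>
      0 \<le> (\<Sum>l\<in>L. c l * indicator (Pi\<^sub>E players (R l)) a)"
  shows "0 \<le> (\<Sum>l\<in>L. c l * rect_mass \<kappa> (R l))"
proof -
  have RF: "R l i \<in> F i" if "l \<in> L" "i \<in> players" for l i
    using L(2)[OF that(1)] that(2) by (auto simp: sides_def PiE_iff)
  \<comment> \<open>\<open>J\<close> collects the players already integrated out; the others are
    still held at their actions in \<open>a\<close>.\<close>
  have "0 \<le> (\<Sum>l\<in>L. c l * ((\<Prod>i\<in>J. \<kappa> i (R l i)) * (\<Prod>i\<in>players - J. indicator (R l i) (a i))))"
    if "J \<subseteq> players" "a \<in> action_profiles" for J a
    using finite_subset[OF that(1) finite_atLeastAtMost] that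
  proof (induction J arbitrary: a rule: finite_induct)
    case empty
    then show ?case using nonneg[of a] by (simp add: indicator_rectangle del: One_nat_def)
  next
    case (insert j J)
    then have j: "j \<in> players" and jJ: "j \<notin> J" by auto
    define c' where "c' l = c l * ((\<Prod>i\<in>J. \<kappa> i (R l i)) *
      (\<Prod>i\<in>players - insert j J. indicator (R l i) (a i)))" for l
    have "0 * \<kappa> j (A j) \<le> (\<Sum>l\<in>L. c' l * \<kappa> j (R l j \<inter> A j))"
    proof (rule additive_sum_ge[OF field_of_sets[OF j]])
      fix x assume x: "x \<in> A j"
      have eq: "players - J = insert j (players - insert j J)" using j jJ by auto
      have "(\<Prod>i\<in>players - J. indicator (R l i) ((a(j := x)) i)) =
          indicator (R l j) x * (\<Prod>i\<in>players - insert j J. indicator (R l i) (a i) :: real)" for l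
        unfolding eq by (subst prod.insert) (auto intro: prod.cong)
      \<comment> \<open>The action of \<open>j\<close> is the variable of integration, so the
        induction hypothesis is needed at every \<open>a(j := x)\<close>.\<close>
      moreover have "a(j := x) \<in> action_profiles"
        using insert.prems(2) x j by (auto simp: PiE_iff extensional_def)
      ultimately show "0 \<le> (\<Sum>l\<in>L. c' l * indicator (R l j) x)"
        using insert.IH[of "a(j := x)"] insert.prems(1)
        by (simp add: c'_def mult_ac del: One_nat_def fun_upd_apply sum_mult_indicator)
    qed (use L RF j profilesD[OF \<kappa> j] action_in_field in auto)
    also have "(\<Sum>l\<in>L. c' l * \<kappa> j (R l j \<inter> A j)) =
      (\<Sum>l\<in>L. c l * ((\<Prod>i\<in>insert j J. \<kappa> i (R l i)) *
        (\<Prod>i\<in>players - insert j J. indicator (R l i) (a i))))"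
      using insert.hyps field_subset[OF j RF] j
      by (intro sum.cong) (auto simp: c'_def Int_absorb2)
    finally show ?case by simp
  qed
  \<comment> \<open>With all players integrated out no indicator is left, and any action profile
    will do.\<close>
  from this[of players] action_profiles_nonempty show ?thesis
    by (auto simp: rect_mass_def)
qed

text \<open>The sides of the full rectangle. It has mass 1 under every profile, so it represents
  constants, and replacing a single side recovers the charge of one player.\<close>

definition whole :: "nat \<Rightarrow> 'a set" where
  "whole = restrict A players"

lemma whole_in_sides: "whole \<in> sides"
  using action_in_field by (auto simp: whole_def sides_def)

lemma PiE_whole: "Pi\<^sub>E players whole = action_profiles"
  by (rule PiE_cong) (simp add: whole_def)

lemma rect_mass_whole: "\<kappa> \<in> profiles \<Longrightarrow> rect_mass \<kappa> whole = 1"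
  using profilesD(3) by (auto simp: rect_mass_def whole_def intro!: prod.neutral)

lemma represents_add_const:
  assumes "represents m c R f"
  shows "represents (Suc m) (c(m := e)) (R(m := whole)) (\<lambda>a. f a + e)"
  unfolding represents_def
proof (intro conjI allI impI ballI)
  fix l assume "l < Suc m"
  then show "(R(m := whole)) l \<in> sides"
    using assms whole_in_sides by (cases "l = m") (auto simp: represents_def)
next
  fix a assume a: "a \<in> action_profiles"
  have "f a = (\<Sum>l<m. c l * indicator (Pi\<^sub>E players (R l)) a)"
    using assms a by (simp add: represents_def del: One_nat_def sum_mult_indicator)
  also have "\<dots> = (\<Sum>l<m. (c(m := e)) l * indicator (Pi\<^sub>E players ((R(m := whole)) l)) a)"
    by (rule sum.cong) auto
  finally show "f a + e =
      (\<Sum>l<Suc m. (c(m := e)) l * indicator (Pi\<^sub>E players ((R(m := whole)) l)) a)"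
    using a by (simp add: PiE_whole del: One_nat_def sum_mult_indicator)
qed

text \<open>Positivity applied to the difference of \<open>g\<close> and \<open>f\<close>, the two
  families of rectangles being kept apart by a disjoint sum of index sets. For equal functions it
  shows that the value does not depend on the representation.\<close>

lemma represents_mono:
  assumes \<kappa>: "\<kappa> \<in> profiles" and f: "represents m c R f" and g: "represents p d S g"
    and le: "\<And>a. a \<in> action_profiles \<Longrightarrow> f a \<le> g a"
  shows "(\<Sum>l<m. c l * rect_mass \<kappa> (R l)) \<le> (\<Sum>l<p. d l * rect_mass \<kappa> (S l))"
proof -
  let ?c = "case_sum d (\<lambda>l. - c l)" and ?R = "case_sum S R" and ?L = "{..<p} <+> {..<m}"
  have "0 \<le> (\<Sum>l\<in>?L. ?c l * rect_mass \<kappa> (?R l))"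
  proof (rule rect_sum_nonneg[OF \<kappa>])
    show "finite ?L" by simp
    show "?R l \<in> sides" if "l \<in> ?L" for l using that f g by (auto simp: represents_def)
    fix a assume "a \<in> action_profiles"
    then show "0 \<le> (\<Sum>l\<in>?L. ?c l * indicator (Pi\<^sub>E players (?R l)) a)"
      using le[of a] f g
      by (simp add: sum.Plus represents_def sum_negf del: One_nat_def sum_mult_indicator)
  qed
  then show ?thesis by (simp add: sum.Plus sum_negf)
qed

end

section \<open>Continuity and multilinearity of expected payoffs\<close>

lemma continuous_on_eval [continuous_intros]:
  "continuous_on S (\<lambda>\<kappa>. (\<kappa> :: 'i \<Rightarrow> 'j \<Rightarrow> 'b::topological_space) i E)"
proof (rule continuous_on_product_then_coordinatewise)
  show "continuous_on S (\<lambda>\<kappa>. \<kappa> i)"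
    by (rule continuous_on_subset[OF continuous_on_product_coordinates]) simp
qed

context strategy_fields
begin

lemma continuous_on_rect_mass: "continuous_on S (\<lambda>\<kappa>. rect_mass \<kappa> R)"
  unfolding rect_mass_def by (intro continuous_intros)

definition mix_strategy :: "nat \<Rightarrow> nat \<Rightarrow> (nat \<Rightarrow> real) \<Rightarrow> (nat \<Rightarrow> 'a set \<Rightarrow> real) \<Rightarrow> 'a set \<Rightarrow> real" where
  "mix_strategy i m x t = (\<lambda>E\<in>F i. \<Sum>k<m. x k * t k E)"

lemma mix_strategy_in_strategies:
  assumes i: "i \<in> players" and x: "x \<in> prob_simplex m" and t: "\<And>k. k < m \<Longrightarrow> t k \<in> strategies i"
  shows "mix_strategy i m x t \<in> strategies i"
proof -
  interpret algebra "A i" "F i" by (rule field_of_sets[OF i])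
  have x0: "\<And>k. k < m \<Longrightarrow> 0 \<le> x k" and x1: "(\<Sum>k<m. x k) = 1"
    using x by (auto simp: prob_simplex_def)
  have tE: "\<And>k E. k < m \<Longrightarrow> E \<in> F i \<Longrightarrow> 0 \<le> t k E \<and> t k E \<le> 1"
    and tA: "\<And>k. k < m \<Longrightarrow> t k (A i) = 1" and ta: "\<And>k. k < m \<Longrightarrow> additive (F i) (t k)"
    using t by (auto simp: strategies_def charges_def PiE_iff)
  have le1: "(\<Sum>k<m. x k * t k E) \<le> 1" if "E \<in> F i" for E
  proof -
    have "(\<Sum>k<m. x k * t k E) \<le> (\<Sum>k<m. x k)"
      using x0 tE[OF _ that] by (intro sum_mono) (simp add: mult_left_le)
    then show ?thesis by (simp add: x1)
  qed
  have add: "(\<Sum>k<m. x k * t k (X \<union> Y)) = (\<Sum>k<m. x k * t k X) + (\<Sum>k<m. x k * t k Y)"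
    if "X \<in> F i" "Y \<in> F i" "X \<inter> Y = {}" for X Y
    unfolding sum.distrib[symmetric]
    by (intro sum.cong) (auto simp: additiveD[OF ta that(3) that(1,2)] distrib_left)
  show ?thesis
    unfolding strategies_def charges_def mix_strategy_def
    using le1 add x0 tE tA x1 by (auto simp: additive_def intro!: sum_nonneg)
qed

lemma profiles_update: "\<sigma> \<in> profiles \<Longrightarrow> i \<in> players \<Longrightarrow> t \<in> strategies i \<Longrightarrow> \<sigma>(i := t) \<in> profiles"
  by (auto simp: profiles_def PiE_iff extensional_def)

lemma rect_mass_update:
  assumes "i \<in> players"
  shows "rect_mass (\<sigma>(i := t)) R = t (R i) * (\<Prod>j\<in>players - {i}. \<sigma> j (R j))"
  unfolding rect_mass_def using assms
  by (subst prod.remove[of _ i]) (auto intro!: prod.cong)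

lemma rect_mass_mix:
  assumes "i \<in> players" "R \<in> sides"
  shows "rect_mass (\<sigma>(i := mix_strategy i m x t)) R = (\<Sum>k<m. x k * rect_mass (\<sigma>(i := t k)) R)"
proof -
  have "R i \<in> F i" using assms by (auto simp: sides_def)
  then show ?thesis
    by (simp add: rect_mass_update[OF assms(1)] mix_strategy_def sum_distrib_right mult.assoc)
qed

end

context fa_game
begin

text \<open>Shifting a simple function within \<open>e\<close> of \<open>u i\<close> by
  \<open>-e\<close> and \<open>+e\<close> sandwiches \<open>u i\<close>. The lower one competes in
  the supremum; the upper one bounds it by monotonicity. The approximant is chosen before \<kappa>,
  so the estimate is uniform over profiles.\<close>

lemma expected_payoff_approx:
  assumes i: "i \<in> players" and e: "0 < e"
  shows "\<exists>(m::nat) c R. (\<forall>l<m. R l \<in> sides) \<and> (\<forall>\<kappa>\<in>profiles.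
      \<bar>expected_payoff i \<kappa> - (\<Sum>l<m. c l * rect_mass \<kappa> (R l))\<bar> \<le> e)"
proof -
  obtain f where f: "\<And>k::nat. simple (f k)" "uniform_limit action_profiles f (u i) sequentially"
    using payoff_uniform_limit[OF i] by blast
  obtain k where k: "\<forall>a\<in>action_profiles. dist (f k a) (u i a) < e"
    using uniform_limitD[OF f(2) e] by (auto simp: eventually_sequentially)
  obtain m c R where rep: "represents m c R (f k)" using f(1)[of k] by (auto simp: simple_def)
  have "\<bar>expected_payoff i \<kappa> - (\<Sum>l<m. c l * rect_mass \<kappa> (R l))\<bar> \<le> e"
    if \<kappa>: "\<kappa> \<in> profiles" for \<kappa>
  proof -
    let ?v = "\<Sum>l<m. c l * rect_mass \<kappa> (R l)"
    let ?S = "{v. \<exists>f. simple f \<and> (\<forall>a\<in>action_profiles. f a \<le> u i a) \<and> has_value \<kappa> f v}"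
    have shift: "(\<Sum>l<Suc m. (c(m := d)) l * rect_mass \<kappa> ((R(m := whole)) l)) = ?v + d" for d
      by (simp add: rect_mass_whole[OF \<kappa>] cong: sum.cong_simp)
    have low: "?v - e \<in> ?S"
    proof (intro CollectI exI conjI)
      note r = represents_add_const[OF rep, of "- e"]
      show "simple (\<lambda>a. f k a + - e)" unfolding simple_def using r by blast
      show "\<forall>a\<in>action_profiles. f k a + - e \<le> u i a" using k by (force simp: dist_real_def)
      show "has_value \<kappa> (\<lambda>a. f k a + - e) (?v - e)"
        unfolding has_value_def using r shift[of "- e"] by (metis diff_conv_add_uminus)
    qed
    have up: "v \<le> ?v + e" if v: "v \<in> ?S" for v
    proof -
      obtain g p d S where "represents p d S g" and "\<forall>a\<in>action_profiles. g a \<le> u i a"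
        and v: "v = (\<Sum>l<p. d l * rect_mass \<kappa> (S l))"
        using v by (auto simp: has_value_def)
      then have "v \<le> (\<Sum>l<Suc m. (c(m := e)) l * rect_mass \<kappa> ((R(m := whole)) l))"
        unfolding v using k
        by (intro represents_mono[OF \<kappa> _ represents_add_const[OF rep]]) (force simp: dist_real_def)+
      then show ?thesis by (simp only: shift)
    qed
    have "?v - e \<le> Sup ?S"
      by (rule cSup_upper[OF low]) (use up in \<open>auto simp: bdd_above_def\<close>)
    moreover have "Sup ?S \<le> ?v + e"
      by (rule cSup_least) (use low up in blast)+
    ultimately show ?thesis by (simp add: expected_payoff_def abs_le_iff)
  qed
  moreover have "\<forall>l<m. R l \<in> sides" using rep by (simp add: represents_def)
  ultimately show ?thesis by blast
qed

lemma expected_payoff_limit: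
  assumes i: "i \<in> players"
  shows "\<exists>(m :: nat \<Rightarrow> nat) c R. (\<forall>k. \<forall>l<m k. R k l \<in> sides) \<and>
    uniform_limit profiles (\<lambda>k \<kappa>. \<Sum>l<m k. c k l * rect_mass \<kappa> (R k l))
      (expected_payoff i) sequentially"
proof -
  have "\<forall>k. \<exists>(m::nat) c R. (\<forall>l<m. R l \<in> sides) \<and> (\<forall>\<kappa>\<in>profiles.
      \<bar>expected_payoff i \<kappa> - (\<Sum>l<m. c l * rect_mass \<kappa> (R l))\<bar> \<le> 1 / Suc k)"
    by (intro allI expected_payoff_approx[OF i]) simp
  from choice[OF this] obtain m :: "nat \<Rightarrow> nat" where "\<forall>k. \<exists>c R. (\<forall>l<m k. R l \<in> sides) \<and> (\<forall>\<kappa>\<in>profiles.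
      \<bar>expected_payoff i \<kappa> - (\<Sum>l<m k. c l * rect_mass \<kappa> (R l))\<bar> \<le> 1 / Suc k)" ..
  from choice[OF this] obtain c where "\<forall>k. \<exists>R. (\<forall>l<m k. R l \<in> sides) \<and> (\<forall>\<kappa>\<in>profiles.
      \<bar>expected_payoff i \<kappa> - (\<Sum>l<m k. c k l * rect_mass \<kappa> (R l))\<bar> \<le> 1 / Suc k)" ..
  from choice[OF this] obtain R where R: "\<forall>k. (\<forall>l<m k. R k l \<in> sides) \<and> (\<forall>\<kappa>\<in>profiles.
      \<bar>expected_payoff i \<kappa> - (\<Sum>l<m k. c k l * rect_mass \<kappa> (R k l))\<bar> \<le> 1 / Suc k)" ..
  have sides: "\<And>k l. l < m k \<Longrightarrow> R k l \<in> sides"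
    and approx: "\<And>k \<kappa>. \<kappa> \<in> profiles \<Longrightarrow>
      \<bar>expected_payoff i \<kappa> - (\<Sum>l<m k. c k l * rect_mass \<kappa> (R k l))\<bar> \<le> 1 / Suc k"
    using R by blast+
  have "uniform_limit profiles (\<lambda>k \<kappa>. \<Sum>l<m k. c k l * rect_mass \<kappa> (R k l))
      (expected_payoff i) sequentially"
  proof (rule uniform_limitI)
    fix e :: real assume "0 < e"
    then have "\<forall>\<^sub>F k in sequentially. 1 / Suc k < e"
      using order_tendstoD(2)[OF LIMSEQ_inverse_real_of_nat] by (simp add: inverse_eq_divide)
    then show "\<forall>\<^sub>F k in sequentially. \<forall>\<kappa>\<in>profiles.
        dist (\<Sum>l<m k. c k l * rect_mass \<kappa> (R k l)) (expected_payoff i \<kappa>) < e"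
    proof (rule eventually_mono, intro ballI)
      fix k \<kappa> assume k: "1 / real (Suc k) < e" and \<kappa>: "\<kappa> \<in> profiles"
      have "dist (expected_payoff i \<kappa>) (\<Sum>l<m k. c k l * rect_mass \<kappa> (R k l)) \<le> 1 / Suc k"
        using approx[OF \<kappa>, of k] by (simp only: dist_real_def)
      then show "dist (\<Sum>l<m k. c k l * rect_mass \<kappa> (R k l)) (expected_payoff i \<kappa>) < e"
        using k by (subst dist_commute) (rule le_less_trans)
    qed
  qed
  then show ?thesis using sides by blast
qed

lemma continuous_on_expected_payoff:
  assumes i: "i \<in> players"
  shows "continuous_on profiles (expected_payoff i)"
proof -
  obtain m :: "nat \<Rightarrow> nat" and c R
    where lim: "uniform_limit profiles (\<lambda>k \<kappa>. \<Sum>l<m k. c k l * rect_mass \<kappa> (R k l))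
      (expected_payoff i) sequentially"
    using expected_payoff_limit[OF i] by blast
  show ?thesis
  proof (rule uniform_limit_theorem[OF _ lim])
    show "\<forall>\<^sub>F k in sequentially.
        continuous_on profiles (\<lambda>\<kappa>. \<Sum>l<m k. c k l * rect_mass \<kappa> (R k l))"
      by (intro always_eventually allI continuous_intros continuous_on_rect_mass)
  qed simp
qed

text \<open>Each rectangle mass is linear in the factor of player \<open>i\<close>, hence so is each
  approximant, and the identity passes to the limit.\<close>

lemma expected_payoff_mix:
  assumes i: "i \<in> players" and \<sigma>: "\<sigma> \<in> profiles"
    and x: "x \<in> prob_simplex p" and t: "\<And>k. k < p \<Longrightarrow> t k \<in> strategies i"
  shows "expected_payoff i (\<sigma>(i := mix_strategy i p x t)) =
    (\<Sum>k<p. x k * expected_payoff i (\<sigma>(i := t k)))"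
proof -
  obtain m :: "nat \<Rightarrow> nat" and c R where R: "\<And>k l. l < m k \<Longrightarrow> R k l \<in> sides"
    and lim: "uniform_limit profiles (\<lambda>k \<kappa>. \<Sum>l<m k. c k l * rect_mass \<kappa> (R k l))
      (expected_payoff i) sequentially"
    using expected_payoff_limit[OF i] by blast
  let ?G = "\<lambda>k \<kappa>. \<Sum>l<m k. c k l * rect_mass \<kappa> (R k l)"
  have "?G k (\<sigma>(i := mix_strategy i p x t)) = (\<Sum>j<p. x j * ?G k (\<sigma>(i := t j)))" for k
  proof -
    have "?G k (\<sigma>(i := mix_strategy i p x t)) =
        (\<Sum>l<m k. \<Sum>j<p. c k l * (x j * rect_mass (\<sigma>(i := t j)) (R k l)))"
      using R by (intro sum.cong) (simp_all add: rect_mass_mix[OF i] sum_distrib_left)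
    also have "\<dots> = (\<Sum>j<p. x j * ?G k (\<sigma>(i := t j)))"
      by (subst sum.swap) (simp add: sum_distrib_left mult.left_commute)
    finally show ?thesis .
  qed
  moreover have "(\<lambda>k. \<Sum>j<p. x j * ?G k (\<sigma>(i := t j)))
      \<longlonglongrightarrow> (\<Sum>j<p. x j * expected_payoff i (\<sigma>(i := t j)))"
    using t by (intro tendsto_intros tendsto_uniform_limitI[OF lim] profiles_update[OF \<sigma> i]) auto
  moreover have "(\<lambda>k. ?G k (\<sigma>(i := mix_strategy i p x t)))
      \<longlonglongrightarrow> expected_payoff i (\<sigma>(i := mix_strategy i p x t))"
    by (intro tendsto_uniform_limitI[OF lim] profiles_update[OF \<sigma> i] mix_strategy_in_strategies[OF i x] t)
  ultimately show ?thesis by (simp add: LIMSEQ_unique)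
qed

end

section \<open>The strategy topology\<close>

lemma continuous_map_into_fun:
  fixes f :: "'x \<Rightarrow> 'i \<Rightarrow> 'b::topological_space"
  assumes "\<And>k. continuous_map X euclidean (\<lambda>x. f x k)"
  shows "continuous_map X euclidean f"
  using assms continuous_map_componentwise_UNIV[of X "\<lambda>_. euclidean" f]
  by (simp add: euclidean_product_topology)

text \<open>A closed part of a Tychonoff product. Off \<open>M\<close> the factor is the single
  default value, and each defining equation involves finitely many coordinates.\<close>

lemma compact_charges: "compact (charges \<Omega> M)"
proof -
  let ?P = "Pi\<^sub>E UNIV (\<lambda>E. if E \<in> M then {0..1} else {undefined}) :: ('a set \<Rightarrow> real) set"
  let ?C = "(\<Inter>X\<in>M. \<Inter>Y\<in>{Y\<in>M. X \<inter> Y = {}}. {\<mu>. \<mu> (X \<union> Y) = \<mu> X + \<mu> Y}) \<inter> {\<mu>. \<mu> \<Omega> = (1::real)}"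
  have "M \<rightarrow>\<^sub>E {0..1} = ?P" by (auto simp: PiE_def Pi_def extensional_def split: if_splits)
  then have eq: "charges \<Omega> M = ?P \<inter> ?C"
    unfolding charges_def additive_def by blast
  have "compact ?P" by (rule compact_PiE_UNIV) auto
  moreover have "closed ?C"
    by (intro closed_Int closed_INT ballI closed_Collect_eq continuous_intros
        continuous_on_product_coordinates)
  ultimately show ?thesis unfolding eq by blast
qed

context strategy_fields
begin

lemma compact_profiles: "compact profiles"
proof -
  have "profiles = Pi\<^sub>E UNIV (\<lambda>i. if i \<in> players then strategies i else {undefined})"
    by (auto simp: profiles_def PiE_def Pi_def extensional_def split: if_splits)
  then show ?thesis
    by (auto intro!: compact_PiE_UNIV simp: strategies_def compact_charges)
qed

text \<open>Identifies the generated topology with that of pointwise convergence, for which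
  compactness is known. Rectangle masses are continuous for pointwise convergence; conversely,
  evaluation at \<open>i\<close> and \<open>E\<close> is the mass of the rectangle with side
  \<open>E\<close> at \<open>i\<close> and full sides elsewhere.\<close>

lemma strategy_topology_eq: "strategy_topology = top_of_set profiles"
proof -
  let ?T = strategy_topology
  define B where "B = {{\<tau> \<in> profiles. \<forall>R\<in>\<R>. \<bar>rect_mass \<kappa> R - rect_mass \<tau> R\<bar> < \<epsilon>} | \<kappa> \<epsilon> \<R>.
        \<kappa> \<in> profiles \<and> \<epsilon> > 0 \<and> finite \<R> \<and> \<R> \<subseteq> sides}"
  have T: "?T = topology_generated_by B" by (simp add: strategy_topology_def B_def)
  have top: "topspace ?T = profiles"
  proof -
    have "profiles \<in> B" if "\<kappa> \<in> profiles" for \<kappa>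
      unfolding B_def by (rule CollectI, rule exI[of _ \<kappa>], rule exI[of _ 1], rule exI[of _ "{}"])
        (use that in auto)
    moreover have "\<Union>B \<subseteq> profiles" by (auto simp: B_def)
    ultimately have "\<Union>B = profiles" by blast
    then show ?thesis by (simp add: T)
  qed
  have fwd: "continuous_map (top_of_set profiles) ?T (\<lambda>x. x)"
    unfolding T continuous_on_generated_topo_iff
  proof (intro conjI allI impI)
    fix U assume "U \<in> B"
    then obtain \<kappa> \<epsilon> \<R> where U: "U = {\<tau> \<in> profiles. \<forall>R\<in>\<R>. \<bar>rect_mass \<kappa> R - rect_mass \<tau> R\<bar> < \<epsilon>}"
      and fin: "finite \<R>" unfolding B_def by blast
    have "open (\<Inter>R\<in>\<R>. {\<tau>. \<bar>rect_mass \<kappa> R - rect_mass \<tau> R\<bar> < \<epsilon>})"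
      using fin by (intro open_INT ballI open_Collect_less continuous_intros continuous_on_rect_mass) auto
    moreover have "U = profiles \<inter> (\<Inter>R\<in>\<R>. {\<tau>. \<bar>rect_mass \<kappa> R - rect_mass \<tau> R\<bar> < \<epsilon>})"
      unfolding U by auto
    ultimately have "openin (top_of_set profiles) U" unfolding openin_open by blast
    moreover have "(\<lambda>x. x) -` U \<inter> topspace (top_of_set profiles) = U" unfolding U by auto
    ultimately show "openin (top_of_set profiles) ((\<lambda>x. x) -` U \<inter> topspace (top_of_set profiles))"
      by simp
  qed (use top in \<open>simp add: T\<close>)
  have mass: "continuous_map ?T euclideanreal (\<lambda>\<tau>. rect_mass \<tau> R)" if R: "R \<in> sides" for R
    unfolding continuous_map_def
  proof (intro conjI allI impI)
    fix V :: "real set" assume "openin euclidean V"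
    then have V: "open V" by simp
    show "openin ?T {\<tau> \<in> topspace ?T. rect_mass \<tau> R \<in> V}"
    proof (subst openin_subopen, intro ballI)
      fix \<kappa> assume "\<kappa> \<in> {\<tau> \<in> topspace ?T. rect_mass \<tau> R \<in> V}"
      then have \<kappa>: "\<kappa> \<in> profiles" "rect_mass \<kappa> R \<in> V" by (auto simp: top)
      obtain \<epsilon> where \<epsilon>: "\<epsilon> > 0" "ball (rect_mass \<kappa> R) \<epsilon> \<subseteq> V"
        using V \<kappa>(2) open_contains_ball by blast
      let ?W = "{\<tau> \<in> profiles. \<forall>R\<in>{R}. \<bar>rect_mass \<kappa> R - rect_mass \<tau> R\<bar> < \<epsilon>}"
      have "?W \<in> B" unfolding B_def using \<kappa> \<epsilon> R by blast
      then have "openin ?T ?W" unfolding T by (rule topology_generated_by_Basis)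
      moreover have "\<kappa> \<in> ?W" using \<kappa> \<epsilon> by simp
      moreover have "?W \<subseteq> {\<tau> \<in> topspace ?T. rect_mass \<tau> R \<in> V}"
        using \<epsilon>(2) by (auto simp: top dist_real_def)
      ultimately show "\<exists>W. openin ?T W \<and> \<kappa> \<in> W \<and> W \<subseteq> {\<tau> \<in> topspace ?T. rect_mass \<tau> R \<in> V}"
        by blast
    qed
  qed simp
  have eval: "continuous_map ?T euclideanreal (\<lambda>\<tau>. \<tau> i E)" for i E
  proof (cases "i \<in> players \<and> E \<in> F i")
    case True
    let ?R = "whole(i := E)"
    have "?R \<in> sides" using whole_in_sides True by (auto simp: sides_def PiE_iff extensional_def)
    moreover have "rect_mass \<tau> ?R = \<tau> i E" if "\<tau> \<in> profiles" for \<tau>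
    proof -
      have "(\<Prod>j\<in>players - {i}. \<tau> j (?R j)) = 1"
        using profilesD(3)[OF that] by (intro prod.neutral) (auto simp: whole_def)
      then show ?thesis unfolding rect_mass_def using True by (subst prod.remove[of _ i]) auto
    qed
    ultimately show ?thesis
      using continuous_map_eq[OF mass, of ?R "\<lambda>\<tau>. \<tau> i E"] by (simp add: top)
  next
    case False
    \<comment> \<open>Off the field the value is the default real; off the players the whole charge
      is the default function. Either way the evaluation is constant on profiles.\<close>
    define y where "y = (if i \<in> players then undefined else (undefined :: 'a set \<Rightarrow> real) E)"
    have "\<tau> i E = y" if "\<tau> \<in> profiles" for \<tau>
      using False that unfolding y_def profiles_def
      by (cases "i \<in> players") (auto simp: strategies_def charges_def PiE_iff extensional_def)
    then show ?thesis
      using continuous_map_eq[of ?T euclideanreal "\<lambda>_. y"] by (auto simp: top)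
  qed
  have "continuous_map ?T euclidean (\<lambda>\<tau>. \<tau>)"
    by (rule continuous_map_into_fun, rule continuous_map_into_fun, rule eval)
  then have bwd: "continuous_map ?T (top_of_set profiles) (\<lambda>\<tau>. \<tau>)"
    by (simp add: continuous_map_in_subtopology top)
  show ?thesis
  proof (rule topology_eq[THEN iffD2], intro allI iffI)
    fix U assume U: "openin ?T U"
    then have "{x \<in> profiles. x \<in> U} = U" using openin_subset[OF U] top by auto
    then show "openin (top_of_set profiles) U"
      using openin_continuous_map_preimage[OF fwd U] by simp
  next
    fix U assume U: "openin (top_of_set profiles) U"
    then have "{x \<in> profiles. x \<in> U} = U" using openin_subset[OF U] by auto
    then show "openin ?T U"
      using openin_continuous_map_preimage[OF bwd U] by (simp add: top)
  qed
qed

end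

section \<open>Perturbed games\<close>

lemma continuous_on_fun_upd:
  fixes f :: "'x::topological_space \<Rightarrow> 'i \<Rightarrow> 'b::topological_space"
  assumes "continuous_on S f" "continuous_on S g"
  shows "continuous_on S (\<lambda>x. (f x)(i := g x))"
proof (rule continuous_on_coordinatewise_then_product)
  fix j show "continuous_on S (\<lambda>x. ((f x)(i := g x)) j)"
    using assms continuous_on_product_then_coordinatewise[OF assms(1), of j]
    by (cases "j = i") auto
qed

context strategy_fields
begin

lemma profiles_nonempty: "profiles \<noteq> {}"
proof -
  have "strategies i \<noteq> {}" if i: "i \<in> players" for i
  proof -
    interpret algebra "A i" "F i" by (rule field_of_sets[OF i])
    obtain a where "a \<in> A i" using actions_nonempty[OF i] by blast
    then have "(\<lambda>E\<in>F i. indicator E a) \<in> strategies i"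
      unfolding strategies_def charges_def additive_def
      by (auto simp: indicator_def split: if_splits)
    then show ?thesis by blast
  qed
  then show ?thesis by (simp add: profiles_def PiE_eq_empty_iff)
qed

text \<open>Each player trembles separately with weight \<open>e\<close>, so rectangle masses become
  products of mixtures and are polynomial in \<open>e\<close>. Payoffs are accordingly handled by
  continuity, not by affinity in \<open>e\<close>.\<close>

definition perturb ::
  "real \<Rightarrow> (nat \<Rightarrow> 'a set \<Rightarrow> real) \<Rightarrow> (nat \<Rightarrow> 'a set \<Rightarrow> real) \<Rightarrow> nat \<Rightarrow> 'a set \<Rightarrow> real" where
  "perturb e s k = (\<lambda>i\<in>players. \<lambda>E\<in>F i. (1 - e) * k i E + e * s i E)"

lemma perturb_in_profiles:
  assumes e: "0 \<le> e" "e \<le> 1" and s: "s \<in> profiles" and k: "k \<in> profiles"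
  shows "perturb e s k \<in> profiles"
  unfolding profiles_def
proof (rule PiE_I)
  fix i assume i: "i \<in> players"
  let ?x = "\<lambda>j. if j = 0 then 1 - e else if j = Suc 0 then e else 0"
  have "mix_strategy i 2 ?x (\<lambda>j. if j = 0 then k i else s i) \<in> strategies i"
    by (rule mix_strategy_in_strategies[OF i])
      (use e profilesD(1)[OF s i] profilesD(1)[OF k i] in
        \<open>auto simp: prob_simplex_def numeral_2_eq_2\<close>)
  moreover have "perturb e s k i = mix_strategy i 2 ?x (\<lambda>j. if j = 0 then k i else s i)"
    using i by (simp add: perturb_def mix_strategy_def numeral_2_eq_2)
  ultimately show "perturb e s k i \<in> strategies i" by simp
next
  fix i assume "i \<notin> players"
  then show "perturb e s k i = undefined" unfolding perturb_def by (rule restrict_apply[THEN trans, OF if_not_P])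
qed

text \<open>Identifies the limit of the perturbed profiles as the weight vanishes. Equality also
  holds off the players and the fields because profiles are extensional.\<close>

lemma perturb_0:
  assumes "k \<in> profiles"
  shows "perturb 0 s k = k"
proof
  fix i show "perturb 0 s k i = k i"
  proof (cases "i \<in> players")
    case True
    then have "k i \<in> extensional (F i)"
      using profilesD(1)[OF assms] by (auto simp: strategies_def charges_def PiE_iff)
    then show ?thesis using True by (auto simp: perturb_def extensional_def)
  next
    case False
    then show ?thesis using assms by (auto simp: perturb_def profiles_def PiE_iff extensional_def)
  qed
qed

lemma continuous_on_perturb:
  assumes f: "continuous_on S f" and g: "continuous_on S g"
  shows "continuous_on S (\<lambda>x. perturb (f x) s (g x))"
proof (rule continuous_on_coordinatewise_then_product, rule continuous_on_coordinatewise_then_product)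
  fix i E
  have "continuous_on S (\<lambda>x. g x i E)"
    by (rule continuous_on_compose2[OF continuous_on_eval[of UNIV] g]) simp
  then have "continuous_on S (\<lambda>x. (1 - f x) * g x i E + f x * s i E)"
    by (intro continuous_on_add continuous_on_mult continuous_on_diff continuous_on_const f)
  then show "continuous_on S (\<lambda>x. perturb (f x) s (g x) i E)"
    by (cases "i \<in> players"; cases "E \<in> F i") (auto simp: perturb_def)
qed

lemma carrier_of_subset_perturb:
  assumes "s \<in> profiles" "k \<in> profiles"
  shows "0 < e \<Longrightarrow> e \<le> 1 \<Longrightarrow> carrier_of s \<subseteq> carrier_of (perturb e s k)"
    and "0 \<le> e \<Longrightarrow> e < 1 \<Longrightarrow> carrier_of k \<subseteq> carrier_of (perturb e s k)"
proof -
  have nn: "0 \<le> s i E" "0 \<le> k i E" if "i \<in> players" "E \<in> F i" for i E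
    using profilesD(4) assms that by auto
  show "carrier_of s \<subseteq> carrier_of (perturb e s k)" if e: "0 < e" "e \<le> 1"
    unfolding carrier_of_def
    by (rule PiE_mono) (use nn e in \<open>auto simp: perturb_def intro!: add_nonneg_pos\<close>)
  show "carrier_of k \<subseteq> carrier_of (perturb e s k)" if e: "0 \<le> e" "e < 1"
    unfolding carrier_of_def
    by (rule PiE_mono) (use nn e in \<open>auto simp: perturb_def intro!: add_pos_nonneg\<close>)
qed

text \<open>An even mixture gives positive mass to every set that either profile charges.\<close>

lemma carriers_directed:
  assumes "C \<in> carriers" "D \<in> carriers"
  obtains B where "B \<in> carriers" "C \<subseteq> B" "D \<subseteq> B"
proof -
  obtain s k where s: "s \<in> profiles" "C = carrier_of s" and k: "k \<in> profiles" "D = carrier_of k"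
    using assms by (auto simp: carriers_def)
  show thesis
  proof
    show "carrier_of (perturb (1/2) s k) \<in> carriers"
      unfolding carriers_def by (rule imageI, rule perturb_in_profiles) (use s k in auto)
    show "C \<subseteq> carrier_of (perturb (1/2) s k)" "D \<subseteq> carrier_of (perturb (1/2) s k)"
      unfolding s(2) k(2) by (rule carrier_of_subset_perturb; use s k in simp)+
  qed
qed

lemma finite_carriers_bound:
  assumes "finite \<C>" "\<C> \<subseteq> carriers"
  shows "\<exists>B\<in>carriers. \<forall>C\<in>\<C>. C \<subseteq> B"
  using assms
proof (induction rule: finite_induct)
  case empty
  then show ?case using profiles_nonempty by (auto simp: carriers_def)
next
  case (insert D \<C>)
  then obtain B where B: "B \<in> carriers" "\<forall>C\<in>\<C>. C \<subseteq> B" by auto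
  have "D \<in> carriers" using insert.prems by simp
  then obtain B' where "B' \<in> carriers" "B \<subseteq> B'" "D \<subseteq> B'" using carriers_directed[OF B(1)] by blast
  then show ?case using B(2) by (intro bexI[of _ B']) auto
qed

end

context fa_game
begin

text \<open>Ky Fan's inequality for the Nikaido-Isoda function: the total gain of the players when
  each moves alone from \<open>k i\<close> to \<open>t i\<close> against the perturbed profile. It
  vanishes on the diagonal. The update at \<open>i\<close> overwrites the player's own tremble, so
  the gain is affine in \<open>t\<close>.\<close>

lemma perturbed_equilibrium:
  assumes e: "0 \<le> e" "e \<le> 1" and s: "s \<in> profiles"
  shows "\<exists>k\<in>profiles. best_response k (perturb e s k)"
proof -
  let ?mix = "\<lambda>m x t. \<lambda>i\<in>players. mix_strategy i m x (\<lambda>k. t k i)"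
  let ?\<phi> = "\<lambda>k t. \<Sum>i\<in>players. expected_payoff i ((perturb e s k)(i := t i)) -
    expected_payoff i ((perturb e s k)(i := k i))"
  note pert = perturb_in_profiles[OF e s]
  have "\<exists>k\<in>profiles. \<forall>t\<in>profiles. ?\<phi> k t \<le> 0"
  proof (rule ky_fan[of profiles ?mix ?\<phi>, OF compact_profiles profiles_nonempty])
    fix m x and t :: "nat \<Rightarrow> nat \<Rightarrow> 'a set \<Rightarrow> real"
    assume x: "x \<in> prob_simplex m" and t: "\<And>k. k < m \<Longrightarrow> t k \<in> profiles"
    have "mix_strategy i m x (\<lambda>k. t k i) \<in> strategies i" if "i \<in> players" for i
      by (rule mix_strategy_in_strategies[OF that x]) (rule profilesD(1)[OF t that])
    then show "?mix m x t \<in> profiles" unfolding profiles_def by (rule restrict_PiE_iff[THEN iffD2, rule_format])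
  next
    fix m and t :: "nat \<Rightarrow> nat \<Rightarrow> 'a set \<Rightarrow> real"
    show "continuous_on (prob_simplex m) (\<lambda>x. ?mix m x t)"
    proof (rule continuous_on_coordinatewise_then_product, rule continuous_on_coordinatewise_then_product)
      fix i E
      have "continuous_on (prob_simplex m) (\<lambda>x. \<Sum>k<m. x k * t k i E)"
        by (intro continuous_on_sum continuous_on_mult continuous_on_const
            continuous_on_subset[OF continuous_on_product_coordinates]) simp
      then show "continuous_on (prob_simplex m) (\<lambda>x. ?mix m x t i E)"
        by (cases "i \<in> players"; cases "E \<in> F i") (auto simp: mix_strategy_def)
    qed
  next
    fix t assume t: "t \<in> profiles"
    have pc: "continuous_on profiles (perturb e s)"
      by (rule continuous_on_perturb) (rule continuous_on_const continuous_on_id)+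
    have "continuous_on profiles (\<lambda>k. expected_payoff i ((perturb e s k)(i := f k)))"
      if i: "i \<in> players" and f: "continuous_on profiles f" "\<And>k. k \<in> profiles \<Longrightarrow> f k \<in> strategies i" for i f
      by (rule continuous_on_compose2[OF continuous_on_expected_payoff[OF i] continuous_on_fun_upd[OF pc f(1)]])
        (use profiles_update[OF pert i f(2)] in blast)
    then show "continuous_on profiles (\<lambda>k. ?\<phi> k t)"
      by (intro continuous_on_sum continuous_on_diff)
        (use profilesD(1) t in \<open>auto intro: continuous_on_subset[OF continuous_on_product_coordinates]\<close>)
  next
    fix m x and t :: "nat \<Rightarrow> nat \<Rightarrow> 'a set \<Rightarrow> real" and k
    assume x: "x \<in> prob_simplex m" and t: "\<And>k. k < m \<Longrightarrow> t k \<in> profiles" and k: "k \<in> profiles"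
    let ?\<sigma> = "perturb e s k"
    have x1: "(\<Sum>j<m. x j) = 1" using x by (simp add: prob_simplex_def)
    have "?\<phi> k (?mix m x t) = (\<Sum>i\<in>players. \<Sum>j<m. x j *
        (expected_payoff i (?\<sigma>(i := t j i)) - expected_payoff i (?\<sigma>(i := k i))))"
    proof (rule sum.cong)
      fix i assume i: "i \<in> players"
      have "expected_payoff i (?\<sigma>(i := ?mix m x t i)) =
          (\<Sum>j<m. x j * expected_payoff i (?\<sigma>(i := t j i)))"
        using expected_payoff_mix[OF i pert[OF k] x, of "\<lambda>j. t j i"] profilesD(1)[OF t i] i by simp
      moreover have "(\<Sum>j<m. x j * expected_payoff i (?\<sigma>(i := k i))) = expected_payoff i (?\<sigma>(i := k i))"
        by (simp add: sum_distrib_right[symmetric] x1)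
      ultimately show "expected_payoff i (?\<sigma>(i := ?mix m x t i)) - expected_payoff i (?\<sigma>(i := k i)) =
          (\<Sum>j<m. x j * (expected_payoff i (?\<sigma>(i := t j i)) - expected_payoff i (?\<sigma>(i := k i))))"
        by (simp only: right_diff_distrib sum_subtractf)
    qed simp
    also have "\<dots> = (\<Sum>j<m. x j * ?\<phi> k (t j))"
      by (subst sum.swap) (simp only: sum_distrib_left)
    finally show "?\<phi> k (?mix m x t) = (\<Sum>j<m. x j * ?\<phi> k (t j))" .
  next
    fix k show "?\<phi> k k \<le> 0" by simp
  qed
  then obtain k where k: "k \<in> profiles" and le: "\<And>t. t \<in> profiles \<Longrightarrow> ?\<phi> k t \<le> 0" by blast
  have "best_response_of i (k i) (perturb e s k)" if i: "i \<in> players" for i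
    unfolding best_response_of_def
  proof (intro conjI ballI)
    show "k i \<in> strategies i" by (rule profilesD(1)[OF k i])
    fix t' assume t': "t' \<in> strategies i"
    \<comment> \<open>The test profile differs from \<open>k\<close> at \<open>i\<close> alone, so
      all other summands vanish.\<close>
    have "?\<phi> k (k(i := t')) = (\<Sum>j\<in>players. if j = i then
        expected_payoff i ((perturb e s k)(i := t')) - expected_payoff i ((perturb e s k)(i := k i)) else 0)"
      by (rule sum.cong) auto
    also have "\<dots> = expected_payoff i ((perturb e s k)(i := t')) - expected_payoff i ((perturb e s k)(i := k i))"
      using i by (simp only: sum.delta finite_atLeastAtMost if_True)
    finally show "expected_payoff i ((perturb e s k)(i := t')) \<le> expected_payoff i ((perturb e s k)(i := k i))"
      using le[OF profiles_update[OF k i t']] by simp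
  qed
  then show ?thesis using k unfolding best_response_def by blast
qed

section \<open>Perfect equilibria\<close>

text \<open>Neighbourhoods and carriers replace the nets in the definition of perfection. This form is
  visibly closed in \<open>\<sigma>\<close> and antitone in \<open>C\<close>.\<close>

definition perfect_against :: "(nat \<Rightarrow> 'a set) set \<Rightarrow> (nat \<Rightarrow> 'a set \<Rightarrow> real) set" where
  "perfect_against C = {\<sigma>. \<forall>V. open V \<longrightarrow> \<sigma> \<in> V \<longrightarrow>
    (\<exists>s\<in>profiles \<inter> V. \<exists>k\<in>profiles \<inter> V. C \<subseteq> carrier_of s \<and> best_response k s)}"

lemma perfect_againstD:
  assumes "\<sigma> \<in> perfect_against C" "open V" "\<sigma> \<in> V"
  obtains s k where "s \<in> profiles" "s \<in> V" "k \<in> profiles" "k \<in> V" "C \<subseteq> carrier_of s" "best_response k s"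
proof -
  have "\<exists>s\<in>profiles \<inter> V. \<exists>k\<in>profiles \<inter> V. C \<subseteq> carrier_of s \<and> best_response k s"
    using assms by (simp add: perfect_against_def)
  then show thesis using that by blast
qed

lemma perfect_imp_perfect_against:
  assumes "perfect \<sigma>" "C \<in> carriers"
  shows "\<sigma> \<in> perfect_against C"
proof -
  obtain I le s k where "perfect_along (I :: ((nat \<Rightarrow> 'a set \<Rightarrow> real) set \<times> (nat \<Rightarrow> 'a set) set \<times> nat) set) le s k \<sigma>"
    using assms(1) unfolding perfect_def by blast
  then have dir: "directed_set I le" and sI: "s ` I \<subseteq> profiles" and kI: "k ` I \<subseteq> profiles"
    and cm: "completely_mixed I le s"
    and ls: "limitin strategy_topology s \<sigma> (tails I le)"
    and lk: "limitin strategy_topology k \<sigma> (tails I le)"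
    and br: "\<forall>a\<in>I. best_response (k a) (s a)"
    unfolding perfect_along_def by auto
  let ?T = "tails I le"
  \<comment> \<open>Best responses are known only for indices in \<open>I\<close>, so the filter
    must be seen to live there.\<close>
  have inI: "\<forall>\<^sub>F a in ?T. a \<in> I"
  proof -
    obtain a where "a \<in> I" using dir by (auto simp: directed_set_def)
    then show ?thesis unfolding tails_def by (intro eventually_INF1[of a]) (auto simp: eventually_principal)
  qed
  have ntriv: "?T \<noteq> bot"
  proof
    assume "?T = bot"
    then have "eventually (\<lambda>_. False) ?T" by simp
    then obtain a where "a \<in> I" "\<forall>b\<in>I. \<not> le a b" unfolding eventually_tails[OF dir] by blast
    moreover have "le a a" using dir \<open>a \<in> I\<close> by (auto simp: directed_set_def reflp_on_def)
    ultimately show False by blast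
  qed
  have cmC: "\<forall>\<^sub>F a in ?T. C \<subseteq> carrier_of (s a)"
    unfolding eventually_tails[OF dir] using cm assms(2) unfolding completely_mixed_def by blast
  show ?thesis
    unfolding perfect_against_def
  proof (intro CollectI allI impI)
    fix V :: "(nat \<Rightarrow> 'a set \<Rightarrow> real) set" assume V: "open V" "\<sigma> \<in> V"
    have "\<sigma> \<in> profiles" using assms(1) by (simp add: perfect_def)
    moreover have "openin strategy_topology (profiles \<inter> V)"
      unfolding strategy_topology_eq using V(1) by (auto simp: openin_open)
    ultimately have "\<forall>\<^sub>F a in ?T. s a \<in> profiles \<inter> V" "\<forall>\<^sub>F a in ?T. k a \<in> profiles \<inter> V"
      using ls lk V(2) unfolding limitin_def by blast+
    with cmC inI have "\<forall>\<^sub>F a in ?T. s a \<in> profiles \<inter> V \<and> k a \<in> profiles \<inter> V \<and> C \<subseteq> carrier_of (s a) \<and> a \<in> I"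
      by eventually_elim blast
    then obtain a where "s a \<in> profiles \<inter> V" "k a \<in> profiles \<inter> V" "C \<subseteq> carrier_of (s a)" "a \<in> I"
      using eventually_happens'[OF ntriv] by blast
    then show "\<exists>s\<in>profiles \<inter> V. \<exists>k\<in>profiles \<inter> V. C \<subseteq> carrier_of s \<and> best_response k s"
      using br by blast
  qed
qed

text \<open>The net is indexed by neighbourhood, carrier and a counter, with a suitable pair chosen
  for each index. Shrinking neighbourhoods give convergence and growing carriers give complete
  mixing. The counter excludes maximal indices even if there is a largest carrier and a smallest
  neighbourhood.\<close>

lemma perfect_againstI:
  assumes \<sigma>: "\<sigma> \<in> profiles" and ag: "\<And>C. C \<in> carriers \<Longrightarrow> \<sigma> \<in> perfect_against C"
  shows "perfect \<sigma>"
proof -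
  define J where "J = {V. open V \<and> \<sigma> \<in> V} \<times> carriers \<times> (UNIV :: nat set)"
  define le where "le = (\<lambda>(V :: (nat \<Rightarrow> 'a set \<Rightarrow> real) set, C :: (nat \<Rightarrow> 'a set) set, m :: nat) (V', C', m').
      V' \<subseteq> V \<and> C \<subseteq> C' \<and> m \<le> m')"
  have "\<forall>x\<in>J. \<exists>p. fst p \<in> profiles \<inter> fst x \<and> snd p \<in> profiles \<inter> fst x \<and>
      fst (snd x) \<subseteq> carrier_of (fst p) \<and> best_response (snd p) (fst p)"
  proof
    fix x assume "x \<in> J"
    then have x: "open (fst x)" "\<sigma> \<in> fst x" "fst (snd x) \<in> carriers" by (auto simp: J_def)
    obtain s k where "s \<in> profiles" "s \<in> fst x" "k \<in> profiles" "k \<in> fst x"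
      "fst (snd x) \<subseteq> carrier_of s" "best_response k s"
      by (rule perfect_againstD[OF ag[OF x(3)] x(1,2)])
    then show "\<exists>p. fst p \<in> profiles \<inter> fst x \<and> snd p \<in> profiles \<inter> fst x \<and>
      fst (snd x) \<subseteq> carrier_of (fst p) \<and> best_response (snd p) (fst p)"
      by (intro exI[of _ "(s, k)"]) simp
  qed
  from bchoice[OF this] obtain p where p: "\<And>x. x \<in> J \<Longrightarrow> fst (p x) \<in> profiles \<inter> fst x \<and>
      snd (p x) \<in> profiles \<inter> fst x \<and> fst (snd x) \<subseteq> carrier_of (fst (p x)) \<and>
      best_response (snd (p x)) (fst (p x))" by blast
  have base: "(V, carrier_of \<sigma>, 0) \<in> J" if "open V" "\<sigma> \<in> V" for V
    using that \<sigma> by (auto simp: J_def carriers_def)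
  have dir: "directed_set J le"
    unfolding directed_set_def
  proof (intro conjI ballI)
    show "J \<noteq> {}" using base[OF open_UNIV UNIV_I] by blast
    show "reflp_on J le" by (auto simp: reflp_on_def le_def)
    show "transp_on J le" by (auto simp: transp_on_def le_def)
  next
    fix x y assume xy: "x \<in> J" "y \<in> J"
    obtain V C m W D l where eq: "x = (V, C, m)" "y = (W, D, l)" by (cases x; cases y) auto
    obtain B where B: "B \<in> carriers" "C \<subseteq> B" "D \<subseteq> B"
      by (rule carriers_directed[of C D]) (use xy in \<open>auto simp: eq J_def\<close>)
    have "(V \<inter> W, B, max m l) \<in> J" using xy B by (auto simp: eq J_def)
    moreover have "le x (V \<inter> W, B, max m l)" "le y (V \<inter> W, B, max m l)"
      using B by (auto simp: eq le_def)
    ultimately show "\<exists>z\<in>J. le x z \<and> le y z" by blast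
  next
    fix x assume x: "x \<in> J"
    obtain V C m where eq: "x = (V, C, m)" by (cases x)
    have "(V, C, Suc m) \<in> J" "le x (V, C, Suc m)" "(V, C, Suc m) \<noteq> x"
      using x by (auto simp: eq J_def le_def)
    then show "\<exists>y\<in>J. le x y \<and> y \<noteq> x" by blast
  qed
  have lim: "limitin strategy_topology f \<sigma> (tails J le)"
    if f: "\<And>x. x \<in> J \<Longrightarrow> f x \<in> profiles \<inter> fst x" for f
    unfolding limitin_def eventually_tails[OF dir] strategy_topology_eq
  proof (intro conjI allI impI)
    show "\<sigma> \<in> topspace (top_of_set profiles)" using \<sigma> by simp
    fix U assume "openin (top_of_set profiles) U \<and> \<sigma> \<in> U"
    then obtain T where T: "open T" "U = profiles \<inter> T" "\<sigma> \<in> T" by (auto simp: openin_open)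
    have "f y \<in> U" if "y \<in> J" "le (T, carrier_of \<sigma>, 0) y" for y
      using f[OF that(1)] that(2) by (cases y) (auto simp: le_def T(2))
    then show "\<exists>x\<in>J. \<forall>y\<in>J. le x y \<longrightarrow> f y \<in> U"
      using base[OF T(1,3)] by blast
  qed
  have "completely_mixed J le (\<lambda>x. fst (p x))"
    unfolding completely_mixed_def
  proof
    fix C assume "C \<in> carriers"
    then have "(UNIV, C, 0) \<in> J" by (simp add: J_def)
    moreover have "C \<subseteq> carrier_of (fst (p y))" if "y \<in> J" "le (UNIV, C, 0) y" for y
      using p[OF that(1)] that(2) by (cases y) (auto simp: le_def)
    ultimately show "\<exists>x\<in>J. \<forall>y\<in>J. le x y \<longrightarrow> C \<subseteq> carrier_of (fst (p y))" by blast
  qed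
  then have "perfect_along J le (\<lambda>x. fst (p x)) (\<lambda>x. snd (p x)) \<sigma>"
    unfolding perfect_along_def using dir lim p by (auto simp: image_subset_iff)
  then show ?thesis by (rule perfectI_along[OF \<sigma>])
qed

lemma perfect_iff: "perfect \<sigma> \<longleftrightarrow> \<sigma> \<in> profiles \<and> (\<forall>C\<in>carriers. \<sigma> \<in> perfect_against C)"
proof
  assume "perfect \<sigma>"
  then show "\<sigma> \<in> profiles \<and> (\<forall>C\<in>carriers. \<sigma> \<in> perfect_against C)"
    using perfect_imp_perfect_against by (simp add: perfect_def)
qed (use perfect_againstI in blast)

text \<open>A strictly profitable deviation from \<sigma> would stay strictly profitable for all
  pairs \<open>(s, k)\<close> near \<open>(\<sigma>, \<sigma>)\<close>, by joint continuity, yet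
  among these are pairs in which \<open>k\<close> is a best response to \<open>s\<close>.\<close>

lemma perfect_imp_nash:
  assumes "perfect \<sigma>"
  shows "nash_equilibrium \<sigma>"
proof -
  have \<sigma>: "\<sigma> \<in> profiles" using assms by (simp add: perfect_def)
  have "expected_payoff i (\<sigma>(i := t)) \<le> expected_payoff i (\<sigma>(i := \<sigma> i))"
    if i: "i \<in> players" and t: "t \<in> strategies i" for i t
  proof (rule ccontr)
    assume "\<not> ?thesis"
    let ?h = "\<lambda>p. expected_payoff i ((fst p)(i := t)) - expected_payoff i ((fst p)(i := snd p i))"
    have snd_i: "continuous_on (profiles \<times> profiles)
        (\<lambda>p :: (nat \<Rightarrow> 'a set \<Rightarrow> real) \<times> (nat \<Rightarrow> 'a set \<Rightarrow> real). snd p i)"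
      by (rule continuous_on_product_then_coordinatewise[OF continuous_on_snd[OF continuous_on_id]])
    have part: "continuous_on (profiles \<times> profiles) (\<lambda>p. expected_payoff i ((fst p)(i := f p)))"
      if f: "continuous_on (profiles \<times> profiles) f" "\<And>p. p \<in> profiles \<times> profiles \<Longrightarrow> f p \<in> strategies i" for f
    proof (rule continuous_on_compose2[OF continuous_on_expected_payoff[OF i]])
      show "continuous_on (profiles \<times> profiles) (\<lambda>p. (fst p)(i := f p))"
        by (rule continuous_on_fun_upd[OF continuous_on_fst[OF continuous_on_id] f(1)])
      show "(\<lambda>p. (fst p)(i := f p)) ` (profiles \<times> profiles) \<subseteq> profiles"
      proof (rule image_subsetI)
        fix p :: "(nat \<Rightarrow> 'a set \<Rightarrow> real) \<times> (nat \<Rightarrow> 'a set \<Rightarrow> real)"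
        assume p: "p \<in> profiles \<times> profiles"
        then have "fst p \<in> profiles" by auto
        then show "(fst p)(i := f p) \<in> profiles" by (rule profiles_update[OF _ i f(2)[OF p]])
      qed
    qed
    have "continuous_on (profiles \<times> profiles) ?h"
    proof (rule continuous_on_diff)
      show "continuous_on (profiles \<times> profiles) (\<lambda>p. expected_payoff i ((fst p)(i := t)))"
        by (rule part) (use t in auto)
      show "continuous_on (profiles \<times> profiles) (\<lambda>p. expected_payoff i ((fst p)(i := snd p i)))"
        by (rule part[OF snd_i]) (use profilesD(1) i in auto)
    qed
    then have "openin (top_of_set (profiles \<times> profiles)) ((profiles \<times> profiles) \<inter> ?h -` {0<..})"
      by (rule continuous_openin_preimage_gen) simp
    then obtain W where W: "open W" "(profiles \<times> profiles) \<inter> ?h -` {0<..} = (profiles \<times> profiles) \<inter> W"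
      by (auto simp: openin_open)
    have "(\<sigma>, \<sigma>) \<in> (profiles \<times> profiles) \<inter> ?h -` {0<..}"
      using \<sigma> \<open>\<not> _\<close> by simp
    then have "(\<sigma>, \<sigma>) \<in> W" unfolding W(2) by simp
    \<comment> \<open>Perfection supplies \<open>s\<close> and \<open>k\<close> in one common
      neighbourhood, so the two factors are intersected below.\<close>
    then obtain X Y where XY: "open X" "open Y" "\<sigma> \<in> X" "\<sigma> \<in> Y" "X \<times> Y \<subseteq> W"
      by (metis open_prod_elim[OF W(1)] mem_Sigma_iff)
    have "carrier_of \<sigma> \<in> carriers" using \<sigma> by (simp add: carriers_def)
    from perfect_imp_perfect_against[OF assms this] obtain s k where
      sk: "s \<in> profiles" "s \<in> X \<inter> Y" "k \<in> profiles" "k \<in> X \<inter> Y" "best_response k s"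
      by (rule perfect_againstD[of _ _ "X \<inter> Y"]) (use XY in auto)
    then have "(s, k) \<in> (profiles \<times> profiles) \<inter> W" using XY(5) by blast
    then have "?h (s, k) > 0" unfolding W(2)[symmetric] by simp
    moreover have "?h (s, k) \<le> 0"
      using sk(5) i t by (simp add: best_response_def best_response_of_def del: One_nat_def)
    ultimately show False by simp
  qed
  then show ?thesis
    unfolding nash_equilibrium_def best_response_def best_response_of_def
    using \<sigma> profilesD(1) by blast
qed

lemma closed_perfect_against: "closed (perfect_against C)"
  unfolding closed_def
proof (subst open_subopen, intro ballI)
  fix \<sigma> assume "\<sigma> \<in> - perfect_against C"
  then obtain V where V: "open V" "\<sigma> \<in> V"
    "\<not> (\<exists>s\<in>profiles \<inter> V. \<exists>k\<in>profiles \<inter> V. C \<subseteq> carrier_of s \<and> best_response k s)"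
    unfolding perfect_against_def by blast
  then have "V \<subseteq> - perfect_against C" unfolding perfect_against_def by blast
  then show "\<exists>T. open T \<and> \<sigma> \<in> T \<and> T \<subseteq> - perfect_against C" using V by blast
qed

lemma perfect_against_antimono:
  assumes "C \<subseteq> D"
  shows "perfect_against D \<subseteq> perfect_against C"
proof
  fix \<sigma> assume \<sigma>: "\<sigma> \<in> perfect_against D"
  show "\<sigma> \<in> perfect_against C"
    unfolding perfect_against_def
  proof (intro CollectI allI impI)
    fix V :: "(nat \<Rightarrow> 'a set \<Rightarrow> real) set" assume V: "open V" "\<sigma> \<in> V"
    obtain s k where "s \<in> profiles" "s \<in> V" "k \<in> profiles" "k \<in> V" "D \<subseteq> carrier_of s" "best_response k s"
      by (rule perfect_againstD[OF \<sigma> V])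
    with assms show "\<exists>s\<in>profiles \<inter> V. \<exists>k\<in>profiles \<inter> V. C \<subseteq> carrier_of s \<and> best_response k s"
      by blast
  qed
qed

text \<open>A cluster point of equilibria of the games perturbed by \<open>s\<close> with vanishing weights.\<close>

lemma perfect_against_nonempty:
  assumes "C \<in> carriers"
  shows "profiles \<inter> perfect_against C \<noteq> {}"
proof -
  obtain s where s: "s \<in> profiles" and C: "C = carrier_of s" using assms by (auto simp: carriers_def)
  define e where "e j = 1 / real (Suc j)" for j
  have e: "0 < e j" "e j \<le> 1" for j by (auto simp: e_def)
  have "\<forall>j. \<exists>k. k \<in> profiles \<and> best_response k (perturb (e j) s k)"
    using perturbed_equilibrium[OF less_imp_le[OF e(1)] e(2) s] by blast
  from choice[OF this] obtain k where k: "\<And>j. k j \<in> profiles"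
    and br: "\<And>j. best_response (k j) (perturb (e j) s (k j))" by blast
  \<comment> \<open>The cluster point is a common point of the closures of all tails of the
    sequence.\<close>
  have "profiles \<inter> (\<Inter>j. closure (k ` {j..})) \<noteq> {}"
  proof (rule compact_imp_fip_image[OF compact_profiles])
    fix N :: "nat set" assume N: "finite N"
    have "k (Max N) \<in> closure (k ` {j..})" if "j \<in> N" for j
      by (rule subsetD[OF closure_subset]) (use N that in auto)
    then show "profiles \<inter> (\<Inter>j\<in>N. closure (k ` {j..})) \<noteq> {}" using k by blast
  qed simp
  then obtain \<sigma> where \<sigma>: "\<sigma> \<in> profiles" and cl: "\<And>j. \<sigma> \<in> closure (k ` {j..})" by blast
  have "\<sigma> \<in> perfect_against C"
    unfolding perfect_against_def
  proof (intro CollectI allI impI)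
    fix V :: "(nat \<Rightarrow> 'a set \<Rightarrow> real) set" assume V: "open V" "\<sigma> \<in> V"
    \<comment> \<open>Joint continuity at weight 0 and \<sigma> makes the perturbed profile fall
      into \<open>V\<close> once the weight is small and \<open>k j\<close> is close to
      \<sigma>.\<close>
    let ?g = "\<lambda>p. perturb (fst p) s (snd p)"
    have "continuous_on UNIV ?g"
      by (intro continuous_on_perturb continuous_on_fst continuous_on_snd continuous_on_id)
    then have "open (?g -` V)" using V(1) continuous_on_open_vimage[OF open_UNIV] by auto
    moreover have "(0, \<sigma>) \<in> ?g -` V" using V(2) perturb_0[OF \<sigma>] by simp
    ultimately obtain X Y where XY: "open X" "open Y" "(0, \<sigma>) \<in> X \<times> Y" "X \<times> Y \<subseteq> ?g -` V"
      by (rule open_prod_elim)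
    have "e \<longlonglongrightarrow> 0"
      unfolding e_def using LIMSEQ_inverse_real_of_nat by (simp add: inverse_eq_divide)
    then have "\<forall>\<^sub>F j in sequentially. e j \<in> X"
      by (rule topological_tendstoD) (use XY in auto)
    then obtain N where N: "\<And>j. j \<ge> N \<Longrightarrow> e j \<in> X" by (auto simp: eventually_sequentially)
    \<comment> \<open>\<open>Y\<close> controls the perturbed profile, while \<open>V\<close> must
      contain the best response \<open>k j\<close> itself.\<close>
    have "(Y \<inter> V) \<inter> closure (k ` {N..}) \<noteq> {}" using cl[of N] XY V by blast
    then have "(Y \<inter> V) \<inter> k ` {N..} \<noteq> {}"
      using open_Int_closure_eq_empty[OF open_Int[OF XY(2) V(1)]] by blast
    then obtain j where j: "j \<ge> N" "k j \<in> Y" "k j \<in> V" by auto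
    have "perturb (e j) s (k j) \<in> V" using XY(4) N[OF j(1)] j(2) by auto
    moreover have "perturb (e j) s (k j) \<in> profiles"
      by (rule perturb_in_profiles[OF less_imp_le[OF e(1)] e(2) s k])
    moreover have "C \<subseteq> carrier_of (perturb (e j) s (k j))"
      unfolding C by (rule carrier_of_subset_perturb(1)[OF s k e])
    ultimately show "\<exists>s\<in>profiles \<inter> V. \<exists>k\<in>profiles \<inter> V. C \<subseteq> carrier_of s \<and> best_response k s"
      using j(3) k[of j] br[of j] by blast
  qed
  with \<sigma> show ?thesis by blast
qed

section \<open>The set of perfect equilibria as an intersection over carriers\<close>

lemma perfect_equilibria_eq: "perfect_equilibria = profiles \<inter> (\<Inter>C\<in>carriers. perfect_against C)"
proof -
  have "perfect_equilibria = {\<sigma>. perfect \<sigma>}"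
    unfolding perfect_equilibria_def using perfect_imp_nash by blast
  then show ?thesis by (simp only: perfect_iff) blast
qed

lemma perfect_equilibria_nonempty: "perfect_equilibria \<noteq> {}"
  unfolding perfect_equilibria_eq
proof (rule compact_imp_fip_image[OF compact_profiles])
  fix \<C> assume "finite \<C>" "\<C> \<subseteq> carriers"
  from finite_carriers_bound[OF this]
  obtain B where B: "B \<in> carriers" "\<forall>C\<in>\<C>. C \<subseteq> B" by blast
  obtain \<sigma> where \<sigma>: "\<sigma> \<in> profiles" "\<sigma> \<in> perfect_against B" using perfect_against_nonempty[OF B(1)] by blast
  have "\<sigma> \<in> perfect_against C" if "C \<in> \<C>" for C
    using perfect_against_antimono[of C B] B(2) \<sigma>(2) that by blast
  with \<sigma>(1) show "profiles \<inter> (\<Inter>C\<in>\<C>. perfect_against C) \<noteq> {}" by blast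
qed (rule closed_perfect_against)

lemma compact_perfect_equilibria: "compactin strategy_topology perfect_equilibria"
proof -
  have "compact perfect_equilibria"
    unfolding perfect_equilibria_eq
    by (intro compact_Int_closed[OF compact_profiles] closed_INT ballI closed_perfect_against)
  then show ?thesis
    by (simp add: strategy_topology_eq compactin_subtopology perfect_equilibria_eq)
qed

end

theorem theorem12:
  fixes n :: nat
    and A :: "nat \<Rightarrow> 'a set"
    and F :: "nat \<Rightarrow> 'a set set"
    and u :: "nat \<Rightarrow> (nat \<Rightarrow> 'a) \<Rightarrow> real"
  assumes "fa_game n A F u"
  shows "fa_game.perfect_equilibria n A F u \<noteq> {} \<and>
    compactin (strategy_fields.strategy_topology n A F) (fa_game.perfect_equilibria n A F u)"
proof -
  interpret fa_game n A F u by (rule assms)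
  show ?thesis using perfect_equilibria_nonempty compact_perfect_equilibria by blast
qed

end
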